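(* Let $\Omega \subset \mathbb{R}^2$ be a compact connected domain with smooth convex boundary. Then any convex chord (with distinct end points on $\partial\Omega$) which is not an orthogonal geodesic chord converges to a point in finite time under the chord shortening flow relative to $\Sigma = \partial \Omega$.
   Context: Notation: $I = [0,1]$; $\mathbb{R}^2$ carries the standard inner product $\langle\cdot,\cdot\rangle$ and norm $|\cdot|$. Chord: for distinct $p,q \in \partial\Omega$, $C_{p,q}$ is the oriented line segment from $p$ to $q$. Its outward unit conormal $\eta$ is defined at the end points by $\eta(p) = \frac{p-q}{|p-q|} = -\eta(q)$. For $x \in \partial\Omega$, $\eta^T(x)$ denotes the orthogonal projection of $\eta(x)$ onto $T_x\partial\Omega$. Chord shortening flow (relative to $\partial\Omega$): a smooth family of curves $C(u,t): I \times [0,T) \to \mathbb{R}^2$ such that for all $t \in [0,T)$: (a) $p_t := C(0,t)$, $q_t := C(1,t)$ lie on $\partial\Omega$; (b) $C(\cdot,t)$ is a constant speed parametrization of $C_{p_t,q_t}$ (with $p_t\neq q_t$); (c) $\frac{\partial C}{\partial t}(0,t) = -\eta^T(C(0,t))$ and $\frac{\partial C}{\partial t}(1,t) = -\eta^T(C(1,t))$. The solution starting from a given chord is considered on its maximal time interval $[0,T)$; "converges to a point in finite time" means $T<+\infty$ and $C(\cdot,t)$ converges to a point as $t\to T$. Boundary orientation: $\partial\Omega$ is oriented as the boundary of $\Omega$; $\xi$ is the unit tangent field on $\partial\Omega$ such that $\nu := J\xi$ is the normal pointing into $\Omega$, where $J$ is counterclockwise rotation by $\pi/2$. The boundary is convex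 if $k := \langle D_\xi \xi, \nu\rangle \ge 0$ everywhere on $\partial\Omega$, where $D$ is the flat connection. Boundary angle of an oriented chord $C_{p,q}$: $\Theta(p) := \langle \eta(p), \xi(p)\rangle$ and $\Theta(q) := -\langle \eta(q), \xi(q)\rangle$. The chord $C_{p,q}$ is convex if $\Theta(p) \ge 0$ and $\Theta(q) \ge 0$. Orthogonal geodesic chord: a chord whose direction is normal to $\partial\Omega$ at both end points. *)

theory Defs
  imports "HOL-Analysis.Analysis"
begin

section \<open>Smooth maps\<close>

text \<open>
  \<open>Ck_on k f S\<close>: derivatives of \<open>f\<close> up to order \<open>k\<close> exist and are continuous on \<open>S\<close>.
  Derivatives are taken within \<open>S\<close>, hence one-sided at points of \<open>S\<close> on its boundary. The notion
  is only used for open sets and for convex sets with nonempty interior, where derivatives within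
  the set are unique. In finite dimension, asking for every directional derivative
  \<open>x \<mapsto> D x v\<close> to be of class \<open>C\<^sup>k\<close> is the same as asking it of \<open>D\<close>.
\<close>

fun Ck_on :: "nat \<Rightarrow> ('a::euclidean_space \<Rightarrow> 'b::real_normed_vector) \<Rightarrow> 'a set \<Rightarrow> bool" where
  "Ck_on 0 f S \<longleftrightarrow> continuous_on S f"
| "Ck_on (Suc k) f S \<longleftrightarrow>
     (\<exists>D. (\<forall>x\<in>S. (f has_derivative D x) (at x within S)) \<and> (\<forall>v. Ck_on k (\<lambda>x. D x v) S))"

definition smooth_on :: "'a::euclidean_space set \<Rightarrow> ('a \<Rightarrow> 'b::real_normed_vector) \<Rightarrow> bool" where
  "smooth_on S f \<longleftrightarrow> (\<forall>k. Ck_on k f S)"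

section \<open>Planar domains with smooth boundary\<close>

definition J :: "real^2 \<Rightarrow> real^2" where
  "J v = vector [- v $ 2, v $ 1]"

text \<open>
  Near each boundary point \<open>p\<close>, in the orthonormal coordinates
  \<open>s = (x - p) \<bullet> e\<close>, \<open>h = (x - p) \<bullet> J e\<close>, the set is the region \<open>h \<ge> g s\<close> on or above the graph
  of a smooth function. (Replacing \<open>e\<close> by \<open>- e\<close> if necessary, the coordinates can be taken to be
  positively oriented; and only the values of \<open>g\<close> near \<open>0\<close> matter.)
\<close>

definition smooth_boundary :: "(real^2) set \<Rightarrow> bool" where
  "smooth_boundary \<Omega> \<longleftrightarrow>
     (\<forall>p\<in>frontier \<Omega>. \<exists>r>0. \<exists>e. \<exists>g::real \<Rightarrow> real.
        norm e = 1 \<and> smooth_on UNIV g \<and>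
        (\<forall>x\<in>ball p r. x \<in> \<Omega> \<longleftrightarrow> g ((x - p) \<bullet> e) \<le> (x - p) \<bullet> J e))"

definition curve_through ::
  "(real^2) set \<Rightarrow> real^2 \<Rightarrow> real^2 \<Rightarrow> (real \<Rightarrow> real^2) \<Rightarrow> bool" where
  "curve_through \<Sigma> p v c \<longleftrightarrow>
     (\<exists>\<epsilon>>0. smooth_on {-\<epsilon><..<\<epsilon>} c \<and> c ` {-\<epsilon><..<\<epsilon>} \<subseteq> \<Sigma>) \<and>
     c 0 = p \<and> (c has_vector_derivative v) (at 0)"

definition tangent_space :: "(real^2) set \<Rightarrow> real^2 \<Rightarrow> (real^2) set" where
  "tangent_space \<Sigma> p = {v. \<exists>c. curve_through \<Sigma> p v c}"

definition orth_proj :: "(real^2) set \<Rightarrow> real^2 \<Rightarrow> real^2" where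
  "orth_proj V w = (THE y. y \<in> V \<and> (\<forall>z\<in>V. orthogonal (w - y) z))"

definition points_into :: "(real^2) set \<Rightarrow> real^2 \<Rightarrow> real^2 \<Rightarrow> bool" where
  "points_into \<Omega> p v \<longleftrightarrow> (\<exists>\<epsilon>>0. \<forall>s. 0 < s \<and> s < \<epsilon> \<longrightarrow> p + s *\<^sub>R v \<in> interior \<Omega>)"

definition bdry_tangent :: "(real^2) set \<Rightarrow> real^2 \<Rightarrow> real^2" where
  "bdry_tangent \<Omega> p =
     (THE \<xi>. \<xi> \<in> tangent_space (frontier \<Omega>) p \<and> norm \<xi> = 1 \<and> points_into \<Omega> p (J \<xi>))"

text \<open>
  \<open>D\<^sub>v X\<close> at \<open>p\<close>, for a vector field \<open>X\<close> that is only given along \<open>\<Sigma>\<close> and \<open>v\<close> tangent to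
  \<open>\<Sigma>\<close> at \<open>p\<close>: the derivative of \<open>X\<close> along any curve in \<open>\<Sigma>\<close> through \<open>p\<close> with velocity \<open>v\<close>.
\<close>

definition flat_connection ::
  "(real^2) set \<Rightarrow> (real^2 \<Rightarrow> real^2) \<Rightarrow> real^2 \<Rightarrow> real^2 \<Rightarrow> real^2" where
  "flat_connection \<Sigma> X p v =
     (THE w. \<forall>c. curve_through \<Sigma> p v c \<longrightarrow> ((\<lambda>s. X (c s)) has_vector_derivative w) (at 0))"

definition bdry_curvature :: "(real^2) set \<Rightarrow> real^2 \<Rightarrow> real" where
  "bdry_curvature \<Omega> p =
     flat_connection (frontier \<Omega>) (bdry_tangent \<Omega>) p (bdry_tangent \<Omega> p) \<bullet> J (bdry_tangent \<Omega> p)"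

definition convex_boundary :: "(real^2) set \<Rightarrow> bool" where
  "convex_boundary \<Omega> \<longleftrightarrow> (\<forall>p\<in>frontier \<Omega>. bdry_curvature \<Omega> p \<ge> 0)"

section \<open>Chords\<close>

text \<open>
  An oriented chord \<open>C\<^sub>p\<^sub>,\<^sub>q\<close> is given by its end points. \<open>conormal p q\<close> is its outward unit conormal
  at the first argument, so that \<open>\<eta>(p) = conormal p q\<close> and \<open>\<eta>(q) = conormal q p = - \<eta>(p)\<close>.
\<close>

definition conormal :: "real^2 \<Rightarrow> real^2 \<Rightarrow> real^2" where
  "conormal x y = (x - y) /\<^sub>R norm (x - y)"

definition start_angle :: "(real^2) set \<Rightarrow> real^2 \<Rightarrow> real^2 \<Rightarrow> real" where
  "start_angle \<Omega> p q = conormal p q \<bullet> bdry_tangent \<Omega> p"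

definition end_angle :: "(real^2) set \<Rightarrow> real^2 \<Rightarrow> real^2 \<Rightarrow> real" where
  "end_angle \<Omega> p q = - (conormal q p \<bullet> bdry_tangent \<Omega> q)"

definition convex_chord :: "(real^2) set \<Rightarrow> real^2 \<Rightarrow> real^2 \<Rightarrow> bool" where
  "convex_chord \<Omega> p q \<longleftrightarrow> start_angle \<Omega> p q \<ge> 0 \<and> end_angle \<Omega> p q \<ge> 0"

definition orthogonal_geodesic_chord :: "(real^2) set \<Rightarrow> real^2 \<Rightarrow> real^2 \<Rightarrow> bool" where
  "orthogonal_geodesic_chord \<Sigma> p q \<longleftrightarrow>
     (\<forall>v\<in>tangent_space \<Sigma> p. orthogonal (q - p) v) \<and>
     (\<forall>v\<in>tangent_space \<Sigma> q. orthogonal (q - p) v)"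

section \<open>The chord shortening flow\<close>

text \<open>
  Time intervals are \<open>[0,T)\<close> with \<open>0 < T \<le> \<infinity>\<close>. The constant speed parametrization of the chord
  \<open>C\<^sub>p\<^sub>,\<^sub>q\<close> over \<open>[0,1]\<close> is \<open>linepath p q\<close>, i.e. \<open>u \<mapsto> (1 - u) p + u q\<close>. Time derivatives are
  one-sided at \<open>t = 0\<close>.
\<close>

definition time_interval :: "ereal \<Rightarrow> real set" where
  "time_interval T = {t. 0 \<le> t \<and> ereal t < T}"

definition chord_shortening_flow ::
  "(real^2) set \<Rightarrow> (real \<Rightarrow> real \<Rightarrow> real^2) \<Rightarrow> ereal \<Rightarrow> bool" where
  "chord_shortening_flow \<Sigma> C T \<longleftrightarrow>
     0 < T \<and>
     smooth_on ({0..1} \<times> time_interval T) (\<lambda>(u, t). C u t) \<and>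
     (\<forall>t\<in>time_interval T.
        C 0 t \<in> \<Sigma> \<and> C 1 t \<in> \<Sigma> \<and> C 0 t \<noteq> C 1 t \<and>
        (\<forall>u\<in>{0..1}. C u t = linepath (C 0 t) (C 1 t) u) \<and>
        ((\<lambda>s. C 0 s) has_vector_derivative
           - orth_proj (tangent_space \<Sigma> (C 0 t)) (conormal (C 0 t) (C 1 t)))
          (at t within time_interval T) \<and>
        ((\<lambda>s. C 1 s) has_vector_derivative
           - orth_proj (tangent_space \<Sigma> (C 1 t)) (conormal (C 1 t) (C 0 t)))
          (at t within time_interval T))"

definition maximal_chord_flow ::
  "(real^2) set \<Rightarrow> real^2 \<Rightarrow> real^2 \<Rightarrow> (real \<Rightarrow> real \<Rightarrow> real^2) \<Rightarrow> ereal \<Rightarrow> bool" where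
  "maximal_chord_flow \<Sigma> p q C T \<longleftrightarrow>
     chord_shortening_flow \<Sigma> C T \<and> C 0 0 = p \<and> C 1 0 = q \<and>
     (\<nexists>C' T'. T < T' \<and> chord_shortening_flow \<Sigma> C' T' \<and>
        (\<forall>u\<in>{0..1}. \<forall>t\<in>time_interval T. C' u t = C u t))"

definition converges_to_point_in_finite_time :: "(real \<Rightarrow> real \<Rightarrow> real^2) \<Rightarrow> ereal \<Rightarrow> bool" where
  "converges_to_point_in_finite_time C T \<longleftrightarrow>
     (\<exists>T'. T = ereal T' \<and>
        (\<exists>x. uniform_limit {0..1} (\<lambda>t u. C u t) (\<lambda>u. x) (at_left T')))"

end

theory Submission
  imports Defs
begin

text \<open>
  Let \<open>z = (p, q)\<close> be a chord and let \<open>A\<close>, \<open>B\<close> be the angles that it makes with the boundary at its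
  end points, so that convexity of the chord means \<open>cos A \<ge> 0\<close> and \<open>cos B \<ge> 0\<close>. Under the flow the
  length decreases at the rate \<open>cos\<^sup>2 A + cos\<^sup>2 B\<close> (\<open>length_derivative\<close>), so everything depends on a
  positive lower bound for this rate. It comes from the boundary arc that the two end points cut
  off: they move towards each other along it, and its total curvature \<open>A + B\<close> is less than \<open>\<pi>\<close>
  unless the chord is orthogonal to the boundary at both ends. As the arc shrinks and the curvature
  is nonnegative, \<open>A + B\<close> does not increase, and
  \<open>cos\<^sup>2 A + cos\<^sup>2 B = 1 + cos (A + B) * cos (A - B)\<close> stays bounded below.

  The cosines and sines of the angles are inner products of the chord direction with the boundary
  tangents and normals, and \<open>cos (A + B)\<close> is the inner product of
  the two tangents (\<open>cos_turn\<close>). The monotonicity of \<open>A + B\<close> (\<open>cos_turn_nondecreasing\<close>) uses two sign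
  conditions. The sines are nonnegative because the domain is convex (\<open>sines_nonneg\<close>): nonnegative
  boundary curvature makes it locally convex, and a compact connected locally convex set is convex
  (\<open>locally_convex_imp_convex\<close>). The cosines stay nonnegative (\<open>convex_chord_preserved\<close>) because,
  multiplied by the length, they satisfy a linear system whose off-diagonal coefficients are
  nonnegative (\<open>scaled_cosines_derivative\<close>, \<open>cooperative_system_nonneg\<close>).

  Hence the maximal time is finite. The end points have bounded speed and converge, and if their
  limits were distinct, the solution could be continued from the limiting chord
  (\<open>chord_ode_continuation\<close>). For this, and for the existence of a maximal solution
  (\<open>maximal_chord_ode\<close>), the flow is treated as an ordinary differential equation. In a boundary chart
  it extends to one with a smooth vector field on an open set of \<open>\<real>\<^sup>2 \<times> \<real>\<^sup>2\<close> that keeps the end points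
  on the boundary (\<open>smooth_chord_field_extension\<close>); existence then follows by the contraction principle
  (\<open>ode_local_solution\<close>) and smoothness by bootstrapping (\<open>ode_solution_smooth\<close>).
\<close>

section \<open>Calculus of maps of class \<open>C\<^sup>k\<close>\<close>

lemma Ck_on_SucI:
  assumes "\<And>x. x \<in> S \<Longrightarrow> (f has_derivative D x) (at x within S)"
    and "\<And>v. Ck_on k (\<lambda>x. D x v) S"
  shows "Ck_on (Suc k) f S"
  using assms by auto

lemma Ck_on_SucE:
  assumes "Ck_on (Suc k) f S"
  obtains D where "\<And>x. x \<in> S \<Longrightarrow> (f has_derivative D x) (at x within S)"
    and "\<And>v. Ck_on k (\<lambda>x. D x v) S"
  using assms by auto

lemma Ck_on_Suc_imp: "Ck_on (Suc k) f S \<Longrightarrow> Ck_on k f S"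
proof (induction k arbitrary: f)
  case 0
  then show ?case
    by (auto simp: continuous_on_eq_continuous_within dest: has_derivative_continuous)
next
  case (Suc k)
  from Suc.prems obtain D where "\<And>x. x \<in> S \<Longrightarrow> (f has_derivative D x) (at x within S)"
    and "\<And>v. Ck_on (Suc k) (\<lambda>x. D x v) S"
    by (rule Ck_on_SucE) blast
  with Suc.IH show ?case by (intro Ck_on_SucI) auto
qed

lemma Ck_on_continuous: "Ck_on k f S \<Longrightarrow> continuous_on S f"
  by (induction k) (auto intro: Ck_on_Suc_imp simp del: Ck_on.simps(2) simp: Ck_on_Suc_imp)

lemma Ck_on_subset: "Ck_on k f S \<Longrightarrow> T \<subseteq> S \<Longrightarrow> Ck_on k f T"
proof (induction k arbitrary: f)
  case 0
  then show ?case by (auto intro: continuous_on_subset)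
next
  case (Suc k)
  from Suc.prems(1) obtain D where "\<And>x. x \<in> S \<Longrightarrow> (f has_derivative D x) (at x within S)"
    and "\<And>v. Ck_on k (\<lambda>x. D x v) S"
    by (rule Ck_on_SucE) blast
  with Suc show ?case
    by (intro Ck_on_SucI[where D = D]) (auto intro: has_derivative_subset)
qed

lemma Ck_on_cong:
  assumes "Ck_on k f S" and eq: "\<And>x. x \<in> S \<Longrightarrow> f x = g x"
  shows "Ck_on k g S"
proof (cases k)
  case 0
  with assms(1) continuous_on_cong[OF refl eq, of S "\<lambda>x. x"] show ?thesis by simp
next
  case (Suc m)
  from assms(1)[unfolded Suc] obtain D
    where "\<And>x. x \<in> S \<Longrightarrow> (f has_derivative D x) (at x within S)"
    and "\<And>v. Ck_on m (\<lambda>x. D x v) S"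
    by (rule Ck_on_SucE) blast
  then show ?thesis unfolding Suc
    by (intro Ck_on_SucI[where D = D]) (auto intro: has_derivative_transform simp: eq[symmetric])
qed

lemma Ck_on_const: "Ck_on k (\<lambda>x. c) S"
proof (induction k arbitrary: c)
  case (Suc k)
  then show ?case by (intro Ck_on_SucI[where D = "\<lambda>x v. 0"]) auto
qed simp

lemma Ck_on_bounded_linear:
  assumes "bounded_linear L"
  shows "Ck_on k L S"
proof (cases k)
  case 0
  then show ?thesis using assms by (simp add: linear_continuous_on)
next
  case (Suc m)
  then show ?thesis
    by (auto intro!: Ck_on_SucI[where D = "\<lambda>x. L"] Ck_on_const bounded_linear_imp_has_derivative assms
        simp del: Ck_on.simps(2))
qed

lemma Ck_on_add:
  "Ck_on k f S \<Longrightarrow> Ck_on k g S \<Longrightarrow> Ck_on k (\<lambda>x. f x + g x) S"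
proof (induction k arbitrary: f g)
  case 0
  then show ?case by (auto intro: continuous_on_add)
next
  case (Suc k)
  from Suc.prems(1) obtain Df where f: "\<And>x. x \<in> S \<Longrightarrow> (f has_derivative Df x) (at x within S)"
      "\<And>v. Ck_on k (\<lambda>x. Df x v) S"
    by (rule Ck_on_SucE) blast
  from Suc.prems(2) obtain Dg where g: "\<And>x. x \<in> S \<Longrightarrow> (g has_derivative Dg x) (at x within S)"
      "\<And>v. Ck_on k (\<lambda>x. Dg x v) S"
    by (rule Ck_on_SucE) blast
  show ?case
    by (rule Ck_on_SucI[where D = "\<lambda>x v. Df x v + Dg x v"])
       (auto intro: has_derivative_add f g Suc.IH)
qed

lemma Ck_on_sum:
  "finite A \<Longrightarrow> (\<And>i. i \<in> A \<Longrightarrow> Ck_on k (f i) S) \<Longrightarrow> Ck_on k (\<lambda>x. \<Sum>i\<in>A. f i x) S"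
  by (induction A rule: finite_induct) (auto intro: Ck_on_const Ck_on_add)

lemma (in bounded_bilinear) Ck_on_prod:
  "Ck_on k f S \<Longrightarrow> Ck_on k g S \<Longrightarrow> Ck_on k (\<lambda>x. prod (f x) (g x)) S"
proof (induction k arbitrary: f g)
  case 0
  then show ?case by (auto intro: continuous_on)
next
  case (Suc k)
  from Suc.prems(1) obtain Df where f: "\<And>x. x \<in> S \<Longrightarrow> (f has_derivative Df x) (at x within S)"
      "\<And>v. Ck_on k (\<lambda>x. Df x v) S"
    by (rule Ck_on_SucE) blast
  from Suc.prems(2) obtain Dg where g: "\<And>x. x \<in> S \<Longrightarrow> (g has_derivative Dg x) (at x within S)"
      "\<And>v. Ck_on k (\<lambda>x. Dg x v) S"
    by (rule Ck_on_SucE) blast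
  show ?case
    by (rule Ck_on_SucI[where D = "\<lambda>x v. prod (f x) (Dg x v) + prod (Df x v) (g x)"])
       (auto intro!: FDERIV f g Ck_on_add Suc.IH Ck_on_Suc_imp[OF Suc.prems(1)]
          Ck_on_Suc_imp[OF Suc.prems(2)])
qed

lemmas Ck_on_scaleR = bounded_bilinear.Ck_on_prod[OF bounded_bilinear_scaleR]
  and Ck_on_mult = bounded_bilinear.Ck_on_prod[OF bounded_bilinear_mult]
  and Ck_on_inner = bounded_bilinear.Ck_on_prod[OF bounded_bilinear_inner]

lemma Ck_on_diff: "Ck_on k f S \<Longrightarrow> Ck_on k g S \<Longrightarrow> Ck_on k (\<lambda>x. f x - g x) S"
  using Ck_on_add[of k f S "\<lambda>x. (-1) *\<^sub>R g x"] Ck_on_scaleR[OF Ck_on_const[of k "-1::real" S], of g]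
  by simp

text \<open>
  By linearity the directional derivative \<open>Df (g x) (Dg x v)\<close> of a composition is a finite sum of
  products of coordinates of \<open>Dg x v\<close> with directional derivatives of \<open>f\<close> along fixed basis
  vectors, composed with \<open>g\<close>; to each of these the induction hypothesis applies.
\<close>

lemma Ck_on_compose:
  fixes g :: "'a::euclidean_space \<Rightarrow> 'b::euclidean_space"
  shows "Ck_on k f T \<Longrightarrow> Ck_on k g S \<Longrightarrow> g ` S \<subseteq> T \<Longrightarrow> Ck_on k (\<lambda>x. f (g x)) S"
proof (induction k arbitrary: f)
  case 0
  then show ?case by (auto intro: continuous_on_compose2)
next
  case (Suc k)
  from Suc.prems(1) obtain Df where f: "\<And>x. x \<in> T \<Longrightarrow> (f has_derivative Df x) (at x within T)"
      "\<And>v. Ck_on k (\<lambda>x. Df x v) T"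
    by (rule Ck_on_SucE) blast
  from Suc.prems(2) obtain Dg where g: "\<And>x. x \<in> S \<Longrightarrow> (g has_derivative Dg x) (at x within S)"
      "\<And>v. Ck_on k (\<lambda>x. Dg x v) S"
    by (rule Ck_on_SucE) blast
  have gk: "Ck_on k g S" by (rule Ck_on_Suc_imp[OF Suc.prems(2)])
  show ?case
  proof (rule Ck_on_SucI[where D = "\<lambda>x v. Df (g x) (Dg x v)"])
    show "((\<lambda>x. f (g x)) has_derivative (\<lambda>v. Df (g x) (Dg x v))) (at x within S)" if "x \<in> S" for x
      using that Suc.prems(3)
      by (intro has_derivative_in_compose[OF g(1)] has_derivative_subset[OF f(1)]) auto
    fix v
    have "Ck_on k (\<lambda>x. \<Sum>b\<in>Basis. (Dg x v \<bullet> b) *\<^sub>R Df (g x) b) S"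
      by (intro Ck_on_sum Ck_on_scaleR Ck_on_inner Ck_on_const g(2) finite_Basis
          Suc.IH[OF f(2) gk Suc.prems(3)])
    then show "Ck_on k (\<lambda>x. Df (g x) (Dg x v)) S"
    proof (rule Ck_on_cong)
      fix x assume "x \<in> S"
      then have "linear (Df (g x))"
        using Suc.prems(3) f(1) has_derivative_bounded_linear bounded_linear.linear by blast
      then have "Df (g x) (\<Sum>b\<in>Basis. (Dg x v \<bullet> b) *\<^sub>R b) = (\<Sum>b\<in>Basis. (Dg x v \<bullet> b) *\<^sub>R Df (g x) b)"
        by (simp add: linear_sum linear_cmul)
      then show "(\<Sum>b\<in>Basis. (Dg x v \<bullet> b) *\<^sub>R Df (g x) b) = Df (g x) (Dg x v)"
        by (simp add: euclidean_representation)
    qed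
  qed
qed

lemma Ck_on_fst: "Ck_on k f S \<Longrightarrow> Ck_on k (\<lambda>x. fst (f x)) S"
  for f :: "'a::euclidean_space \<Rightarrow> 'b::euclidean_space \<times> 'c::euclidean_space"
  by (rule Ck_on_compose[OF Ck_on_bounded_linear[OF bounded_linear_fst, of k UNIV]]) auto

lemma Ck_on_snd: "Ck_on k f S \<Longrightarrow> Ck_on k (\<lambda>x. snd (f x)) S"
  for f :: "'a::euclidean_space \<Rightarrow> 'b::euclidean_space \<times> 'c::euclidean_space"
  by (rule Ck_on_compose[OF Ck_on_bounded_linear[OF bounded_linear_snd, of k UNIV]]) auto

lemma Ck_on_Pair: "Ck_on k f S \<Longrightarrow> Ck_on k g S \<Longrightarrow> Ck_on k (\<lambda>x. (f x, g x)) S"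
  for f :: "'a::euclidean_space \<Rightarrow> 'b::real_normed_vector" and g :: "'a \<Rightarrow> 'c::real_normed_vector"
proof (induction k arbitrary: f g)
  case 0
  then show ?case by (auto intro: continuous_on_Pair)
next
  case (Suc k)
  from Suc.prems(1) obtain Df where f: "\<And>x. x \<in> S \<Longrightarrow> (f has_derivative Df x) (at x within S)"
      "\<And>v. Ck_on k (\<lambda>x. Df x v) S"
    by (rule Ck_on_SucE) blast
  from Suc.prems(2) obtain Dg where g: "\<And>x. x \<in> S \<Longrightarrow> (g has_derivative Dg x) (at x within S)"
      "\<And>v. Ck_on k (\<lambda>x. Dg x v) S"
    by (rule Ck_on_SucE) blast
  show ?case
    by (rule Ck_on_SucI[where D = "\<lambda>x v. (Df x v, Dg x v)"])
       (auto intro: has_derivative_Pair f g Suc.IH)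
qed

lemma Ck_on_powr: "Ck_on k (\<lambda>r::real. r powr a) {0<..}"
proof (induction k arbitrary: a)
  case 0
  then show ?case by (auto intro!: continuous_intros)
next
  case (Suc k)
  show ?case
  proof (rule Ck_on_SucI[where D = "\<lambda>r v. (v * a) * r powr (a - 1)"])
    show "((\<lambda>r. r powr a) has_derivative (\<lambda>v. v * a * x powr (a - 1))) (at x within {0<..})"
      if "x \<in> {0<..}" for x
      using that by (auto intro!: derivative_eq_intros simp: powr_diff field_simps)
    show "Ck_on k (\<lambda>r. (v * a) * r powr (a - 1)) {0<..}" for v
      by (rule Ck_on_mult[OF Ck_on_const Suc.IH])
  qed
qed

lemma Ck_on_vector_derivativeI:
  assumes "\<And>t. t \<in> I \<Longrightarrow> (f has_vector_derivative f' t) (at t within I)" and "Ck_on k f' I"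
  shows "Ck_on (Suc k) f I"
  by (rule Ck_on_SucI[where D = "\<lambda>t v. v *\<^sub>R f' t"])
     (use assms in \<open>auto simp: has_vector_derivative_def intro!: Ck_on_scaleR Ck_on_const\<close>)

lemma real_derivative_smooth:
  fixes g :: "real \<Rightarrow> real"
  assumes "smooth_on UNIV g"
  obtains g' where "\<And>s. (g has_real_derivative g' s) (at s)" and "smooth_on UNIV g'"
proof
  have *: "\<exists>D. (\<forall>x. (g has_derivative D x) (at x)) \<and> (\<forall>v. Ck_on k (\<lambda>x. D x v) UNIV)" for k
    using assms[unfolded smooth_on_def, rule_format, of "Suc k"] by simp
  have deriv: "(g has_real_derivative D x 1) (at x)" if "\<forall>x. (g has_derivative D x) (at x)" for D x
  proof -
    have "linear (D x)" using that has_derivative_linear by blast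
    then have "D x v = D x 1 * v" for v
      using linear_cmul[of "D x" v 1] by simp
    then have "D x = (*) (D x 1)" by blast
    then show ?thesis using that[rule_format, of x] unfolding has_field_derivative_def by simp
  qed
  show d: "(g has_real_derivative deriv g s) (at s)" for s
    using *[of 0] deriv DERIV_imp_deriv by metis
  show "smooth_on UNIV (deriv g)"
    unfolding smooth_on_def
  proof
    fix k
    from *[of k] obtain D where D: "\<forall>x. (g has_derivative D x) (at x)" "Ck_on k (\<lambda>x. D x 1) UNIV"
      by blast
    have "D x 1 = deriv g x" for x by (rule DERIV_imp_deriv[OF deriv[OF D(1)], symmetric])
    then show "Ck_on k (deriv g) UNIV" using D(2) by simp
  qed
qed

text \<open>
  In one variable the derivative within a nondegenerate interval is unique, so that local
  derivatives fit together to a global one.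
\<close>

lemma Ck_on_interval_local:
  fixes f :: "real \<Rightarrow> 'b::real_normed_vector"
  assumes I: "\<And>t. t \<in> I \<Longrightarrow> t islimpt I"
  shows "(\<And>t. t \<in> I \<Longrightarrow> \<exists>U. open U \<and> t \<in> U \<and> Ck_on k f (I \<inter> U)) \<Longrightarrow> Ck_on k f I"
proof (induction k arbitrary: f)
  case 0
  show ?case unfolding Ck_on.simps continuous_on_eq_continuous_within
  proof
    fix t assume "t \<in> I"
    with 0 obtain U where "open U" "t \<in> U" "continuous_on (I \<inter> U) f" by force
    then show "continuous (at t within I) f"
      using \<open>t \<in> I\<close> at_within_nhd[of t U "I \<inter> U" I]
      unfolding continuous_on_eq_continuous_within continuous_within
      by (metis IntI Int_assoc Int_absorb)
  qed
next
  case (Suc k)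
  define f' where "f' t = vector_derivative f (at t within I)" for t
  have loc: "(f has_vector_derivative D t 1) (at t within I)" "D t v = v *\<^sub>R D t 1"
    if "t \<in> I" "open U" "t \<in> U" "(f has_derivative D t) (at t within (I \<inter> U))" for t U v and D :: "real \<Rightarrow> real \<Rightarrow> 'b"
  proof -
    have "at t within (I \<inter> U) = at t within I"
      using that(2,3) by (intro at_within_nhd[of _ U]) auto
    then have D: "(f has_derivative D t) (at t within I)" using that(4) by simp
    then have "linear (D t)" using has_derivative_linear by blast
    then show eq: "D t v = v *\<^sub>R D t 1" for v
      using linear_cmul[of "D t" v 1] by simp
    show "(f has_vector_derivative D t 1) (at t within I)"
      unfolding has_vector_derivative_def using D eq by (simp flip: eq)
  qed
  have uniq: "at t within I \<noteq> bot" if "t \<in> I" for t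
    using I[OF that] trivial_limit_within by blast
  have f': "f' t = D t 1"
    if "t \<in> I" "open U" "t \<in> U" "(f has_derivative D t) (at t within (I \<inter> U))" for t U and D :: "real \<Rightarrow> real \<Rightarrow> 'b"
    unfolding f'_def using vector_derivative_within[OF uniq loc(1)] that by blast
  show ?case
  proof (rule Ck_on_vector_derivativeI)
    fix t assume t: "t \<in> I"
    with Suc.prems obtain U where U: "open U" "t \<in> U" "Ck_on (Suc k) f (I \<inter> U)" by blast
    from U(3) obtain D where "(f has_derivative D t) (at t within (I \<inter> U))"
      by (rule Ck_on_SucE) (use t U in blast)
    then show "(f has_vector_derivative f' t) (at t within I)"
      using f'[OF t U(1,2)] loc(1)[OF t U(1,2)] by metis
  next
    show "Ck_on k f' I"
    proof (rule Suc.IH)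
      fix t assume t: "t \<in> I"
      with Suc.prems obtain U where U: "open U" "t \<in> U" "Ck_on (Suc k) f (I \<inter> U)" by blast
      from U(3) obtain D where D: "\<And>x. x \<in> I \<inter> U \<Longrightarrow> (f has_derivative D x) (at x within (I \<inter> U))"
        "Ck_on k (\<lambda>x. D x 1) (I \<inter> U)"
        by (rule Ck_on_SucE) blast
      have "Ck_on k f' (I \<inter> U)"
        by (rule Ck_on_cong[OF D(2)]) (use f' U D(1) in force)
      then show "\<exists>U. open U \<and> t \<in> U \<and> Ck_on k f' (I \<inter> U)" using U by blast
    qed
  qed
qed

text \<open>Bootstrapping: a solution of an autonomous equation gains one derivative from the equation,
  as long as the vector field is smooth.\<close>

lemma ode_solution_smooth:
  fixes F :: "'a::euclidean_space \<Rightarrow> 'a"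
  assumes "smooth_on U F" and "Y ` I \<subseteq> U"
    and ode: "\<And>t. t \<in> I \<Longrightarrow> (Y has_vector_derivative F (Y t)) (at t within I)"
  shows "Ck_on k Y I"
proof (induction k)
  case 0
  then show ?case using ode
    by (auto simp: continuous_on_eq_continuous_within dest: has_vector_derivative_continuous)
next
  case (Suc k)
  show ?case
    by (rule Ck_on_vector_derivativeI[OF ode])
       (use assms Suc in \<open>auto simp: smooth_on_def intro: Ck_on_compose\<close>)
qed

section \<open>Local solutions of ordinary differential equations\<close>

lemma C1_lipschitz_on_cball:
  fixes F :: "'a::euclidean_space \<Rightarrow> 'b::real_normed_vector"
  assumes "Ck_on 1 F U" and "cball x0 r \<subseteq> U"
  shows "\<exists>L>0. \<forall>x\<in>cball x0 r. \<forall>y\<in>cball x0 r. norm (F x - F y) \<le> L * norm (x - y)"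
proof -
  from Ck_on_subset[OF assms] obtain D
    where D: "\<And>x. x \<in> cball x0 r \<Longrightarrow> (F has_derivative D x) (at x within cball x0 r)"
    and cont: "\<And>v. continuous_on (cball x0 r) (\<lambda>x. D x v)"
    by (auto simp del: mem_cball)
  have "\<exists>B>0. \<forall>x\<in>cball x0 r. norm (D x b) \<le> B" for b
    using compact_imp_bounded[OF compact_continuous_image[OF cont compact_cball]]
    unfolding bounded_pos by simp
  then obtain B where B: "\<And>b. B b > 0" "\<And>b x. x \<in> cball x0 r \<Longrightarrow> norm (D x b) \<le> B b"
    by metis
  define L where "L = (\<Sum>b\<in>Basis. B b)"
  have "L > 0" unfolding L_def by (intro sum_pos B) auto
  have "onorm (D x) \<le> L" if x: "x \<in> cball x0 r" for x
  proof (rule onorm_le)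
    fix v
    have lin: "linear (D x)" using D[OF x] has_derivative_linear by blast
    have "D x v = D x (\<Sum>b\<in>Basis. (v \<bullet> b) *\<^sub>R b)" by (simp add: euclidean_representation)
    also have "\<dots> = (\<Sum>b\<in>Basis. (v \<bullet> b) *\<^sub>R D x b)" using lin by (simp add: linear_sum linear_cmul)
    finally have "norm (D x v) \<le> (\<Sum>b\<in>Basis. norm ((v \<bullet> b) *\<^sub>R D x b))"
      using norm_sum[of "\<lambda>b. (v \<bullet> b) *\<^sub>R D x b" Basis] by simp
    also have "\<dots> \<le> (\<Sum>b\<in>Basis. norm v * B b)"
      by (intro sum_mono) (auto intro!: mult_mono B x Basis_le_norm)
    finally show "norm (D x v) \<le> L * norm v"
      by (simp add: L_def sum_distrib_left mult.commute)
  qed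
  from differentiable_bound[OF convex_cball D this]
  have "norm (F x - F y) \<le> L * norm (x - y)" if "x \<in> cball x0 r" "y \<in> cball x0 r" for x y
    using that by blast
  with \<open>L > 0\<close> show ?thesis by blast
qed

text \<open>
  The Picard operator is a contraction of the complete space of continuous curves in a small ball
  around the initial value. Curves are taken on the whole real line, the operator using only their
  values on \<open>[0,\<epsilon>]\<close>.
\<close>

theorem ode_local_solution:
  fixes F :: "'a::euclidean_space \<Rightarrow> 'a"
  assumes "open U" "x0 \<in> U" and C1: "Ck_on 1 F U"
  obtains \<epsilon> Y where "\<epsilon> > 0" "Y 0 = x0" "Y ` {0..\<epsilon>} \<subseteq> U"
    and "\<And>t. t \<in> {0..\<epsilon>} \<Longrightarrow> (Y has_vector_derivative F (Y t)) (at t within {0..\<epsilon>})"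
proof -
  obtain r where r: "r > 0" "cball x0 r \<subseteq> U"
    using assms(1,2) open_contains_cball by blast
  obtain L where L: "L > 0"
    "\<And>x y. x \<in> cball x0 r \<Longrightarrow> y \<in> cball x0 r \<Longrightarrow> norm (F x - F y) \<le> L * norm (x - y)"
    using C1_lipschitz_on_cball[OF C1 r(2)] by blast
  have Fc: "continuous_on (cball x0 r) F"
    using Ck_on_continuous[OF C1] continuous_on_subset r(2) by blast
  obtain M where M: "M > 0" "\<And>x. x \<in> cball x0 r \<Longrightarrow> norm (F x) \<le> M"
    using compact_imp_bounded[OF compact_continuous_image[OF Fc compact_cball]]
    unfolding bounded_pos by auto
  define \<epsilon> where "\<epsilon> = min (r / M) (1 / (2 * L))"
  have \<epsilon>: "\<epsilon> > 0" "M * \<epsilon> \<le> r" "L * \<epsilon> \<le> 1/2"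
    using r(1) L(1) M(1) by (auto simp: \<epsilon>_def min_def field_simps)
  define cl where "cl t = max 0 (min \<epsilon> t)" for t
  have cl: "cl t \<in> {0..\<epsilon>}" for t using \<epsilon>(1) by (auto simp: cl_def)
  define G where "G f t = x0 + integral {0..cl t} (\<lambda>s. F (apply_bcontfun f s))" for f and t :: real
  define S where "S = PiC (UNIV::real set) (\<lambda>_. cball x0 r)"
  have S_D: "apply_bcontfun f t \<in> cball x0 r" if "f \<in> S" for f t
    using that by (auto simp: S_def mem_PiC_iff)
  have Ff: "continuous_on A (\<lambda>s. F (apply_bcontfun f s))" if "f \<in> S" for f A
    by (rule continuous_on_compose2[OF Fc]) (use S_D[OF that] in auto)
  have G_cball: "G f t \<in> cball x0 r" if "f \<in> S" for f t
  proof -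
    have "norm (integral {0..cl t} (\<lambda>s. F (apply_bcontfun f s))) \<le> M * (cl t - 0)"
      using cl[of t] by (intro integral_bound Ff that M S_D) auto
    also have "\<dots> \<le> M * \<epsilon>" using cl[of t] M(1) by simp
    finally show ?thesis using \<epsilon>(2) by (simp add: G_def dist_norm)
  qed
  have G_bcont: "G f \<in> bcontfun" if "f \<in> S" for f
  proof (rule bcontfun_normI)
    have "continuous_on {0..\<epsilon>} (\<lambda>t. integral {0..t} (\<lambda>s. F (apply_bcontfun f s)))"
      by (intro indefinite_integral_continuous_1 integrable_continuous_real Ff that)
    then have "continuous_on UNIV (\<lambda>t. integral {0..cl t} (\<lambda>s. F (apply_bcontfun f s)))"
      by (rule continuous_on_compose2) (use cl in \<open>auto simp: cl_def intro!: continuous_intros\<close>)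
    then show "continuous_on UNIV (G f)" unfolding G_def by (intro continuous_intros)
    show "norm (G f t) \<le> norm x0 + r" for t
      using G_cball[OF that, of t] norm_triangle_ineq2[of "G f t" x0]
      by (simp add: dist_norm norm_minus_commute)
  qed
  have apply_G: "apply_bcontfun (Bcontfun (G f)) = G f" if "f \<in> S" for f
    using G_bcont[OF that] Bcontfun_inverse by blast
  have "\<exists>!f\<in>S. Bcontfun (G f) = f"
  proof (rule Banach_fix)
    show "complete S" unfolding S_def complete_eq_closed by (intro closed_PiC) auto
    have "const_bcontfun x0 \<in> S"
      using r(1) by (auto simp: S_def mem_PiC_iff const_bcontfun.rep_eq)
    then show "S \<noteq> {}" by blast
    show "(0::real) \<le> 1/2" "(1/2::real) < 1" by auto
    show "(\<lambda>f. Bcontfun (G f)) ` S \<subseteq> S"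
      using G_cball apply_G by (auto simp: S_def mem_PiC_iff)
    fix f g assume fg: "f \<in> S" "g \<in> S"
    show "dist (Bcontfun (G f)) (Bcontfun (G g)) \<le> 1/2 * dist f g"
    proof (rule dist_bound)
      fix t
      have "norm (F (apply_bcontfun f s) - F (apply_bcontfun g s)) \<le> L * dist f g" for s
      proof -
        have "norm (F (apply_bcontfun f s) - F (apply_bcontfun g s))
            \<le> L * norm (apply_bcontfun f s - apply_bcontfun g s)"
          by (intro L S_D fg)
        also have "\<dots> \<le> L * dist f g"
          using dist_bounded[of f s g] L(1) by (simp add: dist_norm)
        finally show ?thesis .
      qed
      then have "norm (integral {0..cl t} (\<lambda>s. F (apply_bcontfun f s) - F (apply_bcontfun g s)))
          \<le> (L * dist f g) * (cl t - 0)"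
        using cl[of t] by (intro integral_bound continuous_on_diff Ff fg) auto
      also have "\<dots> \<le> (L * dist f g) * \<epsilon>"
        using cl[of t] L(1) by (intro mult_left_mono) auto
      also have "\<dots> = (L * \<epsilon>) * dist f g" by simp
      also have "\<dots> \<le> 1/2 * dist f g" using \<epsilon>(3) by (intro mult_right_mono) auto
      finally show "dist (apply_bcontfun (Bcontfun (G f)) t) (apply_bcontfun (Bcontfun (G g)) t)
          \<le> 1/2 * dist f g"
        unfolding apply_G[OF fg(1)] apply_G[OF fg(2)] G_def
        by (simp add: dist_norm integral_diff[OF integrable_continuous_real[OF Ff[OF fg(1)]]
              integrable_continuous_real[OF Ff[OF fg(2)]]])
    qed
  qed
  then obtain f where f: "f \<in> S" "Bcontfun (G f) = f" by blast
  define Y where "Y = apply_bcontfun f"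
  have Y: "Y = G f" using apply_G[OF f(1)] f(2) by (simp add: Y_def)
  show thesis
  proof
    show "\<epsilon> > 0" by fact
    show "Y 0 = x0" using \<epsilon>(1) by (simp add: Y G_def cl_def)
    show "Y ` {0..\<epsilon>} \<subseteq> U" using S_D[OF f(1)] r(2) by (auto simp: Y_def)
    fix t assume t: "t \<in> {0..\<epsilon>}"
    have "((\<lambda>t. integral {0..t} (\<lambda>s. F (apply_bcontfun f s))) has_vector_derivative F (Y t))
        (at t within {0..\<epsilon>})"
      unfolding Y_def by (rule integral_has_vector_derivative[OF Ff[OF f(1)] t])
    then have "((\<lambda>t. x0 + integral {0..t} (\<lambda>s. F (apply_bcontfun f s))) has_vector_derivative F (Y t))
        (at t within {0..\<epsilon>})"
      by (auto intro!: derivative_eq_intros)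
    then show "(Y has_vector_derivative F (Y t)) (at t within {0..\<epsilon>})"
    proof (rule has_vector_derivative_transform[OF t, rotated])
      show "Y s = x0 + integral {0..s} (\<lambda>s. F (apply_bcontfun f s))" if "s \<in> {0..\<epsilon>}" for s
        using that by (simp add: Y G_def cl_def)
    qed
  qed
qed

text \<open>
  By the fundamental theorem of calculus the function is an integral of \<open>W\<close>, which is continuous also
  at the exceptional points.
\<close>

lemma has_vector_derivative_across_exceptions:
  fixes Y :: "real \<Rightarrow> 'a::banach"
  assumes "finite E" and Y: "continuous_on {a..b} Y" and W: "continuous_on {a..b} W"
    and deriv: "\<And>t. t \<in> {a<..<b} - E \<Longrightarrow> (Y has_vector_derivative W t) (at t)"
    and t: "t \<in> {a..b}"
  shows "(Y has_vector_derivative W t) (at t within {a..b})"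
proof -
  have eq: "Y s = Y a + integral {a..s} W" if s: "s \<in> {a..b}" for s
  proof -
    have "(W has_integral (Y s - Y a)) {a..s}"
      by (rule fundamental_theorem_of_calculus_interior_strong[OF assms(1)])
         (use s deriv in \<open>auto intro: continuous_on_subset[OF Y]\<close>)
    then show ?thesis by (simp add: integral_unique)
  qed
  have "((\<lambda>s. Y a + integral {a..s} W) has_vector_derivative W t) (at t within {a..b})"
    using integral_has_vector_derivative[OF W t] by (auto intro!: derivative_eq_intros)
  then show ?thesis
    by (rule has_vector_derivative_transform[OF t eq, rotated])
qed

section \<open>Locally convex compact connected sets are convex\<close>

lemma connected_chain:
  fixes S :: "'a::metric_space set"
  assumes "connected S" "x \<in> S" "y \<in> S" "d > 0"
  shows "\<exists>n f. f 0 = x \<and> f n = y \<and> (\<forall>i. f i \<in> S) \<and> (\<forall>i<n. dist (f i) (f (Suc i)) \<le> d)"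
proof -
  define R where "R a b \<longleftrightarrow> a \<in> S \<and> b \<in> S \<and> dist a b \<le> d" for a b
  have sym: "symp R" by (auto simp: symp_def R_def dist_commute)
  have "R\<^sup>*\<^sup>* x y"
  proof (rule connected_equivalence_relation[OF assms(1-3)])
    show "R\<^sup>*\<^sup>* b a" if "R\<^sup>*\<^sup>* a b" for a b
      using that sym by (metis symp_rtranclp sympD)
    show "R\<^sup>*\<^sup>* a c" if "R\<^sup>*\<^sup>* a b" "R\<^sup>*\<^sup>* b c" for a b c
      using that by (rule rtranclp_trans)
    fix a assume a: "a \<in> S"
    show "\<exists>T. openin (top_of_set S) T \<and> a \<in> T \<and> (\<forall>x\<in>T. R\<^sup>*\<^sup>* a x)"
    proof (intro exI conjI ballI)
      show "openin (top_of_set S) (S \<inter> ball a d)" by (simp add: openin_open_Int)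
      show "a \<in> S \<inter> ball a d" using a assms(4) by simp
      show "R\<^sup>*\<^sup>* a z" if "z \<in> S \<inter> ball a d" for z
        using that a by (intro r_into_rtranclp) (auto simp: R_def)
    qed
  qed
  then obtain n where "(R ^^ n) x y" using rtranclp_imp_relpowp by metis
  then obtain f where f: "f 0 = x" "f n = y" "\<forall>i<n. R (f i) (f (Suc i))"
    unfolding relpowp_fun_conv by blast
  \<comment> \<open>Beyond \<open>n\<close> the chain is made constant, so that all of its values lie in \<open>S\<close>.\<close>
  define h where "h i = (if i \<le> n then f i else x)" for i
  show ?thesis
  proof (intro exI[of _ n] exI[of _ h] conjI allI impI)
    show "h i \<in> S" for i
    proof (cases "i < n")
      case True
      then have "R (f i) (f (Suc i))" using f(3) by simp
      then show ?thesis using True by (simp add: h_def R_def)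
    next
      case False
      then have "h i \<in> {x, y}" using f(2) by (cases "i = n") (auto simp: h_def)
      then show ?thesis using assms(2,3) by blast
    qed
    show "dist (h i) (h (Suc i)) \<le> d" if "i < n" for i
    proof -
      have "R (f i) (f (Suc i))" using f(3) that by simp
      then show ?thesis using that by (simp add: h_def R_def)
    qed
  qed (simp_all add: h_def f(1,2))
qed

text \<open>
  Among all chains from \<open>x\<close> to \<open>y\<close> in \<open>S\<close> with a given number of short steps, one of least energy
  exists by compactness. Local convexity allows each of its points to be replaced by the midpoint
  of its neighbours, so they already are the midpoints: the chain is equally spaced on a line, and
  the line segment is covered by short segments, which lie in \<open>S\<close>.
\<close>

theorem locally_convex_imp_convex:
  fixes S :: "'a::euclidean_space set"
  assumes "compact S" "connected S"
    and loc: "\<And>x. x \<in> S \<Longrightarrow> \<exists>U. open U \<and> x \<in> U \<and> convex (S \<inter> U)"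
  shows "convex S"
proof -
  obtain \<rho> where \<rho>: "\<rho> > 0" "\<And>x. x \<in> S \<Longrightarrow> convex (S \<inter> ball x \<rho>)"
  proof -
    define \<G> where "\<G> = {U. open U \<and> convex (S \<inter> U)}"
    have cover: "S \<subseteq> \<Union>\<G>" using loc by (auto simp: \<G>_def)
    obtain \<rho> where "0 < \<rho>" "\<And>x. x \<in> S \<Longrightarrow> \<exists>G\<in>\<G>. ball x \<rho> \<subseteq> G"
      by (rule Heine_Borel_lemma[OF assms(1) cover]) (auto simp: \<G>_def)
    moreover have "convex (S \<inter> ball x \<rho>)" if "G \<in> \<G>" "ball x \<rho> \<subseteq> G" for x G
    proof -
      have "S \<inter> ball x \<rho> = (S \<inter> G) \<inter> ball x \<rho>" using that by auto
      then show ?thesis using that by (auto simp: \<G>_def intro: convex_Int)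
    qed
    ultimately show thesis using that by blast
  qed
  define d where "d = \<rho> / 2"
  have d: "0 < d" "d < \<rho>" using \<rho>(1) by (auto simp: d_def)
  show "convex S" unfolding convex_contains_segment
  proof (intro ballI)
    fix x y assume xy: "x \<in> S" "y \<in> S"
    obtain n and f0 :: "nat \<Rightarrow> 'a" where f0: "f0 0 = x" "f0 n = y" "\<And>i. f0 i \<in> S"
      "\<And>i. i < n \<Longrightarrow> dist (f0 i) (f0 (Suc i)) \<le> d"
      using connected_chain[OF assms(2) xy d(1)] by metis
    define K where "K = (\<Pi>\<^sub>E i\<in>UNIV. S) \<inter> {f. f 0 = x} \<inter> {f. f n = y} \<inter>
      (\<Inter>i<n. {f. dist (f i) (f (Suc i)) \<le> d})"
    have coord: "continuous_on A (\<lambda>f. f i :: 'a)" for A and i :: nat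
      by (rule continuous_on_subset[OF continuous_on_product_coordinates subset_UNIV])
    have "compactin (product_topology (\<lambda>i. euclidean) UNIV) (\<Pi>\<^sub>E i\<in>(UNIV::nat set). S)"
      unfolding compactin_PiE compactin_euclidean_iff using assms(1) by blast
    then have "compact (\<Pi>\<^sub>E i\<in>(UNIV::nat set). S)"
      unfolding euclidean_product_topology compactin_euclidean_iff .
    moreover have "closed {f. f i = (a::'a)}" for i :: nat and a
      by (intro closed_Collect_eq coord continuous_on_const)
    moreover have "closed (\<Inter>i<n. {f. dist (f i) (f (Suc i) :: 'a) \<le> d})"
      by (intro closed_INT ballI closed_Collect_le continuous_on_dist coord continuous_on_const)
    ultimately have "compact K" unfolding K_def
      by (intro compact_Int_closed)
    define E where "E f = (\<Sum>i<n. (dist (f i) (f (Suc i) :: 'a))\<^sup>2)" for f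
    have "continuous_on K E" unfolding E_def
      by (intro continuous_on_sum continuous_on_power continuous_on_dist coord)
    moreover have "f0 \<in> K" using f0 by (auto simp: K_def)
    ultimately obtain f where f: "f \<in> K" "\<And>g. g \<in> K \<Longrightarrow> E f \<le> E g"
      using continuous_attains_inf[OF \<open>compact K\<close>, of E] by blast
    have fS: "f i \<in> S" for i using f(1) by (auto simp: K_def PiE_iff)
    have fd: "dist (f i) (f (Suc i)) \<le> d" if "i < n" for i using f(1) that by (auto simp: K_def)
    have f0n: "f 0 = x" "f n = y" using f(1) by (auto simp: K_def)
    have midp: "f (Suc i) = midpoint (f i) (f (Suc (Suc i)))" if i: "Suc i < n" for i
    proof -
      define a b c m where "a = f i" "b = f (Suc i)" "c = f (Suc (Suc i))" "m = midpoint a c"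
      note defs = this
      have ab: "dist b a < \<rho>" "dist b c < \<rho>" "dist a b \<le> d" "dist b c \<le> d"
        using fd[of i] fd[of "Suc i"] i d by (auto simp: defs dist_commute)
      have "m \<in> S"
      proof -
        have "a \<in> S \<inter> ball b \<rho>" "c \<in> S \<inter> ball b \<rho>" using ab fS by (auto simp: defs)
        then have "closed_segment a c \<subseteq> S \<inter> ball b \<rho>"
          using \<rho>(2)[of b] fS by (auto simp: defs convex_contains_segment)
        then show ?thesis using midpoint_in_closed_segment[of a c] by (auto simp: defs)
      qed
      have "dist a c \<le> 2 * d" using dist_triangle[of a c b] ab by simp
      then have md: "dist a m \<le> d" "dist m c \<le> d"
        by (auto simp: defs dist_midpoint)
      define g where "g = f (Suc i := m)"
      have gK: "g \<in> K"
        using f(1) i \<open>m \<in> S\<close> md fd by (auto simp: K_def g_def PiE_iff defs less_Suc_eq)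
      define R where "R = {..<n} - {i, Suc i}"
      have split: "E h = (dist (h i) (h (Suc i)))\<^sup>2 + (dist (h (Suc i)) (h (Suc (Suc i))))\<^sup>2
          + (\<Sum>j\<in>R. (dist (h j) (h (Suc j)))\<^sup>2)" for h
        using i sum.subset_diff[of "{i, Suc i}" "{..<n}" "\<lambda>i. (dist (h i) (h (Suc i)))\<^sup>2"]
        by (simp add: E_def R_def add_ac)
      have "(\<Sum>j\<in>R. (dist (g j) (g (Suc j)))\<^sup>2) = (\<Sum>j\<in>R. (dist (f j) (f (Suc j)))\<^sup>2)"
        by (intro sum.cong) (auto simp: g_def R_def)
      then have "(dist a b)\<^sup>2 + (dist b c)\<^sup>2 \<le> (dist a m)\<^sup>2 + (dist m c)\<^sup>2"
        using f(2)[OF gK] unfolding split[of f] split[of g] by (auto simp: g_def defs)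
      also have "(dist a m)\<^sup>2 + (dist m c)\<^sup>2 = (dist a b)\<^sup>2 + (dist b c)\<^sup>2 - 2 * (dist b m)\<^sup>2"
        unfolding defs(4) midpoint_def dist_norm
        by (simp add: power2_norm_eq_inner inner_diff_left inner_diff_right inner_add_left
            inner_add_right inner_commute algebra_simps) 
      finally have "b = m" by simp
      then show ?thesis by (simp add: defs)
    qed
    define v where "v = f 1 - x"
    have step: "f (Suc i) = f i + v" if "i < n" for i
      using that
    proof (induction i)
      case (Suc i)
      have "2 *\<^sub>R f (Suc i) = f i + f (Suc (Suc i))"
        using midp[OF Suc.prems] by (simp add: midpoint_def)
      then show ?case using Suc by (simp add: scaleR_2 algebra_simps)
    qed (simp add: v_def f0n)
    have fi: "f i = x + real i *\<^sub>R v" if "i \<le> n" for i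
      using that by (induction i) (auto simp: f0n step algebra_simps)
    have seg: "x + t *\<^sub>R v \<in> S" if "i \<le> n" "0 \<le> t" "t \<le> real i" for i t
      using that
    proof (induction i)
      case (Suc i)
      show ?case
      proof (cases "t \<le> real i")
        case False
        define u where "u = t - real i"
        have u: "0 \<le> u" "u \<le> 1" using False Suc.prems by (auto simp: u_def)
        have "f i \<in> S \<inter> ball (f i) \<rho>" "f (Suc i) \<in> S \<inter> ball (f i) \<rho>"
          using fS \<rho>(1) fd[of i] d Suc.prems by auto
        then have "(1 - u) *\<^sub>R f i + u *\<^sub>R f (Suc i) \<in> S \<inter> ball (f i) \<rho>"
          using convexD_alt[OF \<rho>(2)[OF fS[of i]]] u by blast
        moreover have "(1 - u) *\<^sub>R f i + u *\<^sub>R f (Suc i) = x + t *\<^sub>R v"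
          using step[of i] fi[of i] Suc.prems by (simp add: u_def algebra_simps)
        ultimately show ?thesis by simp
      qed (use Suc in simp)
    qed (use xy in simp)
    show "closed_segment x y \<subseteq> S"
    proof
      fix z assume "z \<in> closed_segment x y"
      then obtain u where u: "0 \<le> u" "u \<le> 1" "z = (1 - u) *\<^sub>R x + u *\<^sub>R y"
        by (auto simp: closed_segment_def)
      have "y = x + real n *\<^sub>R v" using fi[of n] f0n by simp
      then have "z = x + (u * real n) *\<^sub>R v" using u(3) by (simp add: algebra_simps)
      then show "z \<in> S" using seg[of n "u * real n"] u by (simp add: mult_left_le_one_le)
    qed
  qed
qed

section \<open>The geometry of a smooth boundary curve\<close>

lemma inner_real2: "x \<bullet> y = x $ 1 * y $ 1 + x $ 2 * y $ 2" for x y :: "real^2"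
  by (simp add: inner_vec_def sum_2)

lemma J_component [simp]: "J v $ 1 = - v $ 2" "J v $ 2 = v $ 1"
  by (simp_all add: J_def)

lemma J_linear: "linear J"
  by (rule linearI) (simp_all add: vec_eq_iff forall_2)

lemma J_scaleR [simp]: "J (a *\<^sub>R v) = a *\<^sub>R J v" and J_add [simp]: "J (v + w) = J v + J w"
  and J_minus [simp]: "J (- v) = - J v"
  using J_linear by (auto simp: linear_cmul linear_add linear_neg)

lemma inner_J [simp]: "v \<bullet> J v = 0" "J v \<bullet> v = 0" "J v \<bullet> J w = v \<bullet> w" "J (J v) = - v"
  by (simp_all add: inner_real2 vec_eq_iff forall_2)

lemma inner_J_left: "J v \<bullet> w = - (v \<bullet> J w)"
  by (simp add: inner_real2)

lemma norm_J [simp]: "norm (J v) = norm v"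
  by (simp add: norm_eq_sqrt_inner)

lemma J_basis_expansion:
  assumes "norm e = 1"
  shows "x = (x \<bullet> e) *\<^sub>R e + (x \<bullet> J e) *\<^sub>R J e"
proof -
  have e: "e $ 1 * e $ 1 + e $ 2 * e $ 2 = 1"
    using assms by (simp add: norm_eq_1 inner_real2)
  have "x $ 1 = (x $ 1 * e $ 1 + x $ 2 * e $ 2) * e $ 1 + (x $ 1 * - e $ 2 + x $ 2 * e $ 1) * - e $ 2"
    using e by algebra
  moreover have "x $ 2 = (x $ 1 * e $ 1 + x $ 2 * e $ 2) * e $ 2 + (x $ 1 * - e $ 2 + x $ 2 * e $ 1) * e $ 1"
    using e by algebra
  ultimately show ?thesis by (simp add: vec_eq_iff forall_2 inner_real2)
qed

lemma J_basis_inner: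
  assumes "norm e = 1"
  shows "x \<bullet> y = (x \<bullet> e) * (y \<bullet> e) + (x \<bullet> J e) * (y \<bullet> J e)"
  by (subst J_basis_expansion[OF assms, of x]) (simp add: inner_add_left inner_add_right inner_commute[of _ y])

lemma orth_proj_line:
  fixes n w :: "real^2"
  assumes "norm n = 1"
  shows "orth_proj (range (\<lambda>a. a *\<^sub>R n)) w = (w \<bullet> n) *\<^sub>R n"
  unfolding orth_proj_def
proof (rule the_equality)
  have n: "n \<bullet> n = 1" using assms by (simp add: norm_eq_1)
  show "(w \<bullet> n) *\<^sub>R n \<in> range (\<lambda>a. a *\<^sub>R n) \<and> (\<forall>z\<in>range (\<lambda>a. a *\<^sub>R n). orthogonal (w - (w \<bullet> n) *\<^sub>R n) z)"
    by (auto simp: orthogonal_def inner_diff_left n)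
  fix y assume y: "y \<in> range (\<lambda>a. a *\<^sub>R n) \<and> (\<forall>z\<in>range (\<lambda>a. a *\<^sub>R n). orthogonal (w - y) z)"
  then obtain a where a: "y = a *\<^sub>R n" by auto
  have "orthogonal (w - y) (1 *\<^sub>R n)" using y by blast
  then show "y = (w \<bullet> n) *\<^sub>R n" using a by (simp add: orthogonal_def inner_diff_left n)
qed

text \<open>The domain lies above a graph near the boundary point \<open>p\<close>. The first two derivatives of the graph
  function are parameters because tangent and curvature of the boundary are computed from them.\<close>

locale boundary_chart =
  fixes \<Omega> :: "(real^2) set" and p e :: "real^2" and r :: real and g g' g'' :: "real \<Rightarrow> real"
  assumes closed: "closed \<Omega>"
    and r: "r > 0" and e: "norm e = 1"
    and smooth: "smooth_on UNIV g" "smooth_on UNIV g'" "continuous_on UNIV g''"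
    and g': "\<And>s. (g has_real_derivative g' s) (at s)"
    and g'': "\<And>s. (g' has_real_derivative g'' s) (at s)"
    and region: "\<And>x. x \<in> ball p r \<Longrightarrow> x \<in> \<Omega> \<longleftrightarrow> g ((x - p) \<bullet> e) \<le> (x - p) \<bullet> J e"
begin

definition abscissa :: "real^2 \<Rightarrow> real" where "abscissa x = (x - p) \<bullet> e"

definition height :: "real^2 \<Rightarrow> real" where "height x = (x - p) \<bullet> J e - g (abscissa x)"

definition graph_point :: "real \<Rightarrow> real^2" where "graph_point s = p + s *\<^sub>R e + g s *\<^sub>R J e"

definition speed :: "real \<Rightarrow> real" where "speed s = sqrt (1 + (g' s)\<^sup>2)"

definition tangent :: "real \<Rightarrow> real^2" where "tangent s = e + g' s *\<^sub>R J e"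

definition unit_tangent :: "real \<Rightarrow> real^2" where "unit_tangent s = tangent s /\<^sub>R speed s"

definition curvature :: "real \<Rightarrow> real" where "curvature s = g'' s / speed s ^ 3"

lemma e_inner [simp]: "e \<bullet> e = 1"
  using e by (simp add: norm_eq_1)

lemma speed_pos [simp]: "speed s > 0" and speed_sq: "(speed s)\<^sup>2 = 1 + (g' s)\<^sup>2"
  by (auto simp: speed_def add_pos_nonneg)

lemma speed_nonzero [simp]: "speed s \<noteq> 0"
  by (rule less_imp_neq[OF speed_pos, symmetric])

lemma speed_mult: "speed s * speed s = 1 + g' s * g' s"
  using speed_sq[of s] by (simp add: power2_eq_square)

lemma g_continuous [continuous_intros]: "continuous_on A g" "continuous_on A g'"
  using smooth(1,2) Ck_on_continuous continuous_on_subset[OF _ subset_UNIV]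
  unfolding smooth_on_def by blast+

lemma height_continuous: "continuous_on A height"
  unfolding height_def abscissa_def
  by (intro continuous_intros continuous_on_compose2[OF g_continuous(1)[of UNIV]]) auto

lemma in_domain_iff: "x \<in> ball p r \<Longrightarrow> x \<in> \<Omega> \<longleftrightarrow> 0 \<le> height x"
  by (simp add: region height_def abscissa_def)

lemma in_interior_iff:
  assumes x: "x \<in> ball p r"
  shows "x \<in> interior \<Omega> \<longleftrightarrow> 0 < height x"
proof
  assume pos: "0 < height x"
  have "open {y. 0 < height y}"
    by (intro open_Collect_less height_continuous continuous_on_const)
  then have "open (ball p r \<inter> {y. 0 < height y})" by blast
  moreover have "ball p r \<inter> {y. 0 < height y} \<subseteq> \<Omega>" using in_domain_iff by auto
  ultimately show "x \<in> interior \<Omega>" using x pos by (intro interiorI) auto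
next
  assume "x \<in> interior \<Omega>"
  then have "x \<in> interior (\<Omega> \<inter> ball p r)" using x by (simp add: interior_Int)
  then obtain d where d: "d > 0" "cball x d \<subseteq> \<Omega> \<inter> ball p r"
    by (meson mem_interior_cball)
  \<comment> \<open>Moving an interior point straight down by \<open>d\<close> lowers its height by exactly \<open>d\<close>.\<close>
  define y where "y = x - d *\<^sub>R J e"
  have "y \<in> cball x d" using d(1) e by (simp add: y_def dist_norm)
  then have "0 \<le> height y" using d(2) in_domain_iff by blast
  moreover have "height y = height x - d"
    by (simp add: y_def height_def abscissa_def inner_diff_left)
  ultimately show "0 < height x" using d(1) by simp
qed

lemma in_frontier_iff: "x \<in> ball p r \<Longrightarrow> x \<in> frontier \<Omega> \<longleftrightarrow> height x = 0"
  using in_interior_iff[of x] in_domain_iff[of x] closed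
  by (auto simp: frontier_def)

lemma abscissa_graph_point [simp]: "abscissa (graph_point s) = s"
  and height_graph_point [simp]: "height (graph_point s) = 0"
  by (simp_all add: graph_point_def abscissa_def height_def inner_add_left inner_diff_left)

lemma graph_point_abscissa: "height x = 0 \<Longrightarrow> graph_point (abscissa x) = x"
  using J_basis_expansion[OF e, of "x - p"]
  by (simp add: graph_point_def height_def abscissa_def algebra_simps)

lemma height_derivative:
  assumes "(c has_vector_derivative v) (at t within I)"
  shows "((\<lambda>t. height (c t)) has_vector_derivative (v \<bullet> J e - g' (abscissa (c t)) * (v \<bullet> e))) (at t within I)"
proof -
  have *: "((\<lambda>t. abscissa (c t)) has_real_derivative (v \<bullet> e)) (at t within I)"
    unfolding abscissa_def has_real_derivative_iff_has_vector_derivative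
    using bounded_linear.has_vector_derivative[OF bounded_linear_inner_left[of e] has_vector_derivative_diff[OF assms has_vector_derivative_const[of p]]]
    by simp
  have "((\<lambda>t. (c t - p) \<bullet> J e) has_real_derivative (v \<bullet> J e)) (at t within I)"
    unfolding has_real_derivative_iff_has_vector_derivative
    using bounded_linear.has_vector_derivative[OF bounded_linear_inner_left[of "J e"] has_vector_derivative_diff[OF assms has_vector_derivative_const[of p]]]
    by simp
  from DERIV_diff[OF this DERIV_chain2[OF g' *]] show ?thesis
    by (simp add: height_def has_real_derivative_iff_has_vector_derivative)
qed

text \<open>Along a curve in the boundary the height vanishes identically, and so does its derivative;
  this fixes the slope of the velocity.\<close>

lemma velocity_tangent:
  assumes c: "(c has_vector_derivative v) (at t within I)" and "t \<in> I" "t islimpt I"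
    and "c ` I \<subseteq> frontier \<Omega>" "c t \<in> ball p r"
  shows "v = (v \<bullet> e) *\<^sub>R tangent (abscissa (c t))"
proof -
  have nb: "at t within I \<noteq> bot" using assms(3) trivial_limit_within by blast
  have "continuous (at t within I) c" by (rule has_vector_derivative_continuous[OF c])
  then have "\<forall>\<^sub>F s in at t within I. c s \<in> ball p r"
    using assms(5) unfolding continuous_within by (rule topological_tendstoD[OF _ open_ball])
  then obtain d where d: "d > 0" "\<And>s. s \<in> I \<Longrightarrow> s \<noteq> t \<Longrightarrow> dist s t < d \<Longrightarrow> c s \<in> ball p r"
    by (auto simp: eventually_at)
  have zero: "0 = height (c s)" if "s \<in> I" "dist s t < d" for s
    using that d(2)[of s] assms(4,5) in_frontier_iff[of "c s"] by (cases "s = t") auto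
  have "((\<lambda>s. height (c s)) has_vector_derivative 0) (at t within I)"
    by (rule has_vector_derivative_transform_within[OF has_vector_derivative_const d(1) assms(2) zero])
  from vector_derivative_unique_within[OF nb this height_derivative[OF c]]
  show ?thesis
    using J_basis_expansion[OF e, of v] by (simp add: tangent_def scaleR_add_right mult.commute)
qed

lemma tangent_speed: "tangent s = speed s *\<^sub>R unit_tangent s"
  by (simp add: unit_tangent_def)

lemma norm_unit_tangent [simp]: "norm (unit_tangent s) = 1"
proof -
  have "tangent s \<bullet> tangent s = (speed s)\<^sup>2"
    unfolding speed_sq
    by (simp add: tangent_def inner_add_left inner_add_right power2_eq_square)
  then have "norm (tangent s) = speed s"
    by (simp add: norm_eq_sqrt_inner less_imp_le)
  then show ?thesis by (simp add: unit_tangent_def less_imp_le)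
qed

lemma unit_tangent_inner_e: "unit_tangent s \<bullet> e = 1 / speed s"
  by (simp add: unit_tangent_def tangent_def inner_add_left divide_inverse)

lemma graph_curve:
  assumes "graph_point s \<in> ball p r"
  shows "\<exists>c. curve_through (frontier \<Omega>) (graph_point s) (a *\<^sub>R tangent s) c"
proof -
  define c where "c t = graph_point (s + t * a)" for t
  have sm: "smooth_on UNIV c"
    unfolding smooth_on_def
  proof
    fix k
    have lin: "Ck_on k (\<lambda>t. s + t * a) UNIV"
      by (intro Ck_on_add Ck_on_const Ck_on_bounded_linear bounded_linear_mult_left)
    have "Ck_on k (\<lambda>t. g (s + t * a)) UNIV"
      by (rule Ck_on_compose[OF _ lin]) (use smooth(1) in \<open>auto simp: smooth_on_def\<close>)
    then show "Ck_on k c UNIV"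
      unfolding c_def graph_point_def by (intro Ck_on_add Ck_on_const Ck_on_scaleR lin)
  qed
  have "continuous_on UNIV c" using Ck_on_continuous sm by (auto simp: smooth_on_def)
  then have "open (c -` ball p r)" by (simp add: open_vimage)
  moreover have "0 \<in> c -` ball p r" using assms by (simp add: c_def)
  ultimately obtain \<epsilon> where \<epsilon>: "\<epsilon> > 0" "ball 0 \<epsilon> \<subseteq> c -` ball p r"
    using open_contains_ball by blast
  have "smooth_on {-\<epsilon><..<\<epsilon>} c" using sm Ck_on_subset unfolding smooth_on_def by blast
  moreover have "c ` {-\<epsilon><..<\<epsilon>} \<subseteq> frontier \<Omega>"
  proof
    fix y assume "y \<in> c ` {-\<epsilon><..<\<epsilon>}"
    then obtain t where t: "y = c t" "t \<in> ball 0 \<epsilon>" by (auto simp: dist_norm)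
    then have "y \<in> ball p r" using \<epsilon>(2) by blast
    then show "y \<in> frontier \<Omega>" by (simp add: in_frontier_iff t(1) c_def)
  qed
  moreover have "(c has_vector_derivative (a *\<^sub>R tangent s)) (at 0)"
  proof -
    have *: "((\<lambda>t. s + t * a) has_real_derivative a) (at 0)" by (auto intro!: derivative_eq_intros)
    from DERIV_chain2[where f = g, OF _ this, of "g' s"] g'[of s]
    have 1: "((\<lambda>t. g (s + t * a)) has_real_derivative (g' s * a)) (at 0)" by simp
    have 2: "((\<lambda>t. s + t * a) has_real_derivative a) (at 0)" by fact
    have "((\<lambda>t. p + (s + t * a) *\<^sub>R e + g (s + t * a) *\<^sub>R J e) has_vector_derivative
        0 + (a *\<^sub>R e) + (g' s * a) *\<^sub>R J e) (at 0)"
      by (intro has_vector_derivative_add has_vector_derivative_const)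
         (use has_vector_derivative_scaleR[OF 2 has_vector_derivative_const[of e]]
              has_vector_derivative_scaleR[OF 1 has_vector_derivative_const[of "J e"]] in simp_all)
    then show ?thesis by (simp add: c_def[abs_def] graph_point_def tangent_def scaleR_add_right mult.commute)
  qed
  moreover have "c 0 = graph_point s" by (simp add: c_def)
  ultimately show ?thesis using \<epsilon>(1) unfolding curve_through_def by blast
qed

lemma tangent_space_eq:
  assumes x: "x \<in> ball p r" "x \<in> frontier \<Omega>"
  shows "tangent_space (frontier \<Omega>) x = range (\<lambda>a. a *\<^sub>R unit_tangent (abscissa x))"
proof (intro equalityI subsetI)
  fix v assume "v \<in> tangent_space (frontier \<Omega>) x"
  then obtain c \<epsilon> where c: "\<epsilon> > 0" "c ` {-\<epsilon><..<\<epsilon>} \<subseteq> frontier \<Omega>" "c 0 = x"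
    "(c has_vector_derivative v) (at 0)"
    by (auto simp: tangent_space_def curve_through_def)
  have at0: "at (0::real) within {-\<epsilon><..<\<epsilon>} = at 0" by (rule at_within_open) (use c(1) in auto)
  then have "(0::real) islimpt {-\<epsilon><..<\<epsilon>}"
    using c(1) by (intro interior_limit_point) (simp add: interior_open)
  then have "v = (v \<bullet> e) *\<^sub>R tangent (abscissa x)"
    using velocity_tangent[of c v 0 "{-\<epsilon><..<\<epsilon>}"] c x(1) at0 by simp
  then show "v \<in> range (\<lambda>a. a *\<^sub>R unit_tangent (abscissa x))"
    using tangent_speed[of "abscissa x"] by (metis scaleR_scaleR rangeI)
next
  fix v assume "v \<in> range (\<lambda>a. a *\<^sub>R unit_tangent (abscissa x))"
  then obtain a where "v = (a / speed (abscissa x)) *\<^sub>R tangent (abscissa x)"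
    by (auto simp: tangent_speed)
  moreover have "graph_point (abscissa x) = x" using graph_point_abscissa x in_frontier_iff by blast
  ultimately show "v \<in> tangent_space (frontier \<Omega>) x"
    using graph_curve[of "abscissa x"] x(1) unfolding tangent_space_def by simp
qed

lemma height_normal_derivative:
  "((\<lambda>t. height (x + t *\<^sub>R (b *\<^sub>R J (unit_tangent (abscissa x))))) has_real_derivative b * speed (abscissa x)) (at 0)"
proof -
  define s n where "s = abscissa x" and "n = J (unit_tangent s)"
  have "((\<lambda>t. x + t *\<^sub>R (b *\<^sub>R n)) has_vector_derivative b *\<^sub>R n) (at 0)"
    by (auto intro!: derivative_eq_intros)
  from height_derivative[OF this]
  have "((\<lambda>t. height (x + t *\<^sub>R (b *\<^sub>R n))) has_real_derivative
      (b *\<^sub>R n \<bullet> J e - g' s * (b *\<^sub>R n \<bullet> e))) (at 0)"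
    by (simp add: has_real_derivative_iff_has_vector_derivative s_def)
  moreover have "n \<bullet> J e = 1 / speed s" by (simp add: n_def unit_tangent_inner_e)
  moreover have "n \<bullet> e = - g' s / speed s"
    by (simp add: n_def unit_tangent_def tangent_def inner_diff_left scaleR_diff_right divide_inverse)
  moreover have "b * (1 / speed s) - g' s * (b * (- g' s / speed s)) = b * (speed s)\<^sup>2 / speed s"
    by (simp add: speed_mult field_simps power2_eq_square)
  moreover have "\<dots> = b * speed s" using speed_pos[of s] by (simp add: power2_eq_square)
  ultimately show ?thesis by (simp add: s_def n_def)
qed

text \<open>Of the two unit tangent vectors only the one with positive \<open>e\<close>-component is turned by \<open>J\<close> into
  a direction in which the height increases.\<close>

lemma bdry_tangent_eq:
  assumes x: "x \<in> ball p r" "x \<in> frontier \<Omega>"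
  shows "bdry_tangent \<Omega> x = unit_tangent (abscissa x)"
  unfolding bdry_tangent_def tangent_space_eq[OF x]
proof (rule the_equality)
  let ?n = "unit_tangent (abscissa x)"
  have h0: "height x = 0" using in_frontier_iff x by blast
  obtain d0 where d0: "d0 > 0" "ball x d0 \<subseteq> ball p r"
    using x(1) open_ball open_contains_ball by metis
  have inball: "x + t *\<^sub>R (b *\<^sub>R J ?n) \<in> ball p r" if "\<bar>t\<bar> < d0" "\<bar>b\<bar> = 1" for t b
  proof -
    have "x + t *\<^sub>R (b *\<^sub>R J ?n) \<in> ball x d0" using that by (simp add: dist_norm abs_mult)
    then show ?thesis using d0(2) by blast
  qed
  show "?n \<in> range (\<lambda>a. a *\<^sub>R ?n) \<and> norm ?n = 1 \<and> points_into \<Omega> x (J ?n)"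
  proof (intro conjI)
    show "?n \<in> range (\<lambda>a. a *\<^sub>R ?n)" by (rule range_eqI[of _ _ 1]) simp
    from DERIV_pos_inc_right[OF height_normal_derivative[of x 1]]
    obtain d where d: "d > 0" "\<And>t. t > 0 \<Longrightarrow> t < d \<Longrightarrow> 0 < height (x + t *\<^sub>R J ?n)"
      using h0 by auto
    have "x + t *\<^sub>R J ?n \<in> interior \<Omega>" if "0 < t" "t < min d d0" for t
      using in_interior_iff[of "x + t *\<^sub>R J ?n"] inball[of t 1] d(2)[of t] that by simp
    then show "points_into \<Omega> x (J ?n)"
      unfolding points_into_def using d(1) d0(1) by (intro exI[of _ "min d d0"]) auto
  qed simp
  fix v assume v: "v \<in> range (\<lambda>a. a *\<^sub>R ?n) \<and> norm v = 1 \<and> points_into \<Omega> x (J v)"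
  then obtain a where a: "v = a *\<^sub>R ?n" by auto
  with v have "\<bar>a\<bar> = 1" by simp
  moreover have "a \<noteq> -1"
  proof
    assume "a = -1"
    from DERIV_neg_dec_right[OF height_normal_derivative[of x "-1"]]
    obtain d where d: "d > 0" "\<And>t. t > 0 \<Longrightarrow> t < d \<Longrightarrow> height (x + t *\<^sub>R ((-1) *\<^sub>R J ?n)) < 0"
      using h0 by auto
    obtain \<epsilon> where \<epsilon>: "\<epsilon> > 0" "\<And>t. 0 < t \<Longrightarrow> t < \<epsilon> \<Longrightarrow> x + t *\<^sub>R J v \<in> interior \<Omega>"
      using v unfolding points_into_def by blast
    define t where "t = min d (min d0 \<epsilon>) / 2"
    have t: "0 < t" "t < d" "t < d0" "t < \<epsilon>" using d(1) d0(1) \<epsilon>(1) by (auto simp: t_def)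
    have "x + t *\<^sub>R ((-1) *\<^sub>R J ?n) \<in> interior \<Omega>"
      using \<epsilon>(2)[OF t(1,4)] a \<open>a = -1\<close> by simp
    then show False
      using in_interior_iff[OF inball[of t "-1"]] d(2)[OF t(1,2)] t by simp
  qed
  ultimately show "v = ?n" using a by (metis abs_1 abs_eq_iff scaleR_one)
qed

lemma speed_derivative: "(speed has_real_derivative g' s * g'' s / speed s) (at s)"
proof -
  have "((\<lambda>s. 1 + (g' s)\<^sup>2) has_real_derivative 2 * g' s * g'' s) (at s)"
    using g''[of s] by (auto intro!: derivative_eq_intros)
  moreover have "0 < 1 + (g' s)\<^sup>2" by (simp add: add_pos_nonneg)
  ultimately have "((\<lambda>s. sqrt (1 + (g' s)\<^sup>2)) has_real_derivative
      inverse (sqrt (1 + (g' s)\<^sup>2)) / 2 * (2 * g' s * g'' s)) (at s)"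
    by (intro DERIV_chain2[OF DERIV_real_sqrt])
  moreover have "inverse (sqrt (1 + (g' s)\<^sup>2)) / 2 * (2 * g' s * g'' s) = g' s * g'' s / speed s"
    unfolding speed_def[symmetric] by (simp add: inverse_eq_divide)
  moreover have "speed = (\<lambda>s. sqrt (1 + (g' s)\<^sup>2))" by (rule ext) (rule speed_def)
  ultimately show ?thesis by metis
qed

lemma unit_tangent_derivative:
  "(unit_tangent has_vector_derivative (g'' s / (speed s)\<^sup>2) *\<^sub>R J (unit_tangent s)) (at s)"
proof -
  have sp: "speed s \<noteq> 0" by simp
  have eq: "g'' s * speed s - g' s * (g' s * g'' s / speed s) = g'' s / speed s"
  proof -
    have "g'' s * speed s - g' s * (g' s * g'' s / speed s)
        = g'' s * (speed s * speed s - g' s * g' s) / speed s"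
      by (simp add: diff_divide_distrib right_diff_distrib)
    also have "speed s * speed s - g' s * g' s = 1" by (simp add: speed_mult)
    finally show ?thesis by simp
  qed
  have 1: "((\<lambda>s. 1 / speed s) has_real_derivative - (g' s * g'' s / (speed s)^3)) (at s)"
    using DERIV_divide[OF DERIV_const[of 1] speed_derivative[of s] sp]
    by (simp add: power3_eq_cube mult.assoc)
  have 2: "((\<lambda>s. g' s / speed s) has_real_derivative g'' s / (speed s)^3) (at s)"
    using DERIV_divide[OF g''[of s] speed_derivative[of s] sp]
    unfolding eq by (simp add: power3_eq_cube mult.assoc)
  have "((\<lambda>s. (1 / speed s) *\<^sub>R e + (g' s / speed s) *\<^sub>R J e) has_vector_derivative
      (- (g' s * g'' s / (speed s)^3)) *\<^sub>R e + (g'' s / (speed s)^3) *\<^sub>R J e) (at s)"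
    by (intro has_vector_derivative_add)
       (use has_vector_derivative_scaleR[OF 1 has_vector_derivative_const[of e]]
            has_vector_derivative_scaleR[OF 2 has_vector_derivative_const[of "J e"]] in simp_all)
  moreover have "unit_tangent = (\<lambda>s. (1 / speed s) *\<^sub>R e + (g' s / speed s) *\<^sub>R J e)"
    by (rule ext) (simp add: unit_tangent_def tangent_def scaleR_add_right divide_inverse mult.commute)
  moreover have "(- (g' s * g'' s / (speed s)^3)) *\<^sub>R e + (g'' s / (speed s)^3) *\<^sub>R J e
      = (g'' s / (speed s)\<^sup>2) *\<^sub>R J (unit_tangent s)"
    using sp by (simp add: unit_tangent_def tangent_def scaleR_add_right field_simps power3_eq_cube power2_eq_square)
  ultimately show ?thesis by simp
qed

text \<open>The turning rate of the tangent along a boundary curve of signed speed \<open>a\<close>. It is stated for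
  derivatives within an arbitrary set of times, to serve both for the two-sided curves in the
  definition of the curvature and for solutions of the flow at their initial time.\<close>

lemma bdry_tangent_derivative:
  assumes c: "(c has_vector_derivative a *\<^sub>R bdry_tangent \<Omega> (c t)) (at t within I)" and t: "t \<in> I"
    and "c ` I \<subseteq> frontier \<Omega>" "c t \<in> ball p r"
  shows "((\<lambda>t. bdry_tangent \<Omega> (c t)) has_vector_derivative
    (a * curvature (abscissa (c t))) *\<^sub>R J (bdry_tangent \<Omega> (c t))) (at t within I)"
proof -
  define s where "s = abscissa (c t)"
  have bt: "bdry_tangent \<Omega> (c t) = unit_tangent s"
    using bdry_tangent_eq assms(3,4) t by (auto simp: s_def)
  have "continuous (at t within I) c" by (rule has_vector_derivative_continuous[OF c])
  then have "\<forall>\<^sub>F s in at t within I. c s \<in> ball p r"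
    using assms(4) unfolding continuous_within by (rule topological_tendstoD[OF _ open_ball])
  then obtain d where d: "d > 0" "\<And>s. s \<in> I \<Longrightarrow> s \<noteq> t \<Longrightarrow> dist s t < d \<Longrightarrow> c s \<in> ball p r"
    by (auto simp: eventually_at)
  have near: "unit_tangent (abscissa (c s)) = bdry_tangent \<Omega> (c s)" if "s \<in> I" "dist s t < d" for s
    using that d(2)[of s] assms(3,4) bdry_tangent_eq[of "c s"] by (cases "s = t") auto
  have "((\<lambda>t. abscissa (c t)) has_vector_derivative a * (1 / speed s)) (at t within I)"
    unfolding abscissa_def
    using bounded_linear.has_vector_derivative[OF bounded_linear_inner_left[of e] has_vector_derivative_diff[OF c has_vector_derivative_const[of p]]]
    by (simp add: bt unit_tangent_inner_e)
  then have 1: "(unit_tangent \<circ> (\<lambda>t. abscissa (c t)) has_vector_derivative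
      (a * (1 / speed s)) *\<^sub>R (g'' s / (speed s)\<^sup>2) *\<^sub>R J (unit_tangent s)) (at t within I)"
    by (rule vector_diff_chain_within)
       (unfold s_def[symmetric], rule has_vector_derivative_at_within, rule unit_tangent_derivative)
  have 2: "(a * (1 / speed s)) *\<^sub>R (g'' s / (speed s)\<^sup>2) *\<^sub>R J (unit_tangent s)
      = (a * curvature s) *\<^sub>R J (unit_tangent s)"
    by (simp add: curvature_def power2_eq_square power3_eq_cube)
  have "((\<lambda>t. unit_tangent (abscissa (c t))) has_vector_derivative
      (a * curvature s) *\<^sub>R J (unit_tangent s)) (at t within I)"
    using 1 unfolding 2 by (simp only: o_def)
  from has_vector_derivative_transform_within[OF this d(1) t near]
  show ?thesis by (simp add: bt flip: s_def)
qed

lemma bdry_curvature_eq: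
  assumes x: "x \<in> ball p r" "x \<in> frontier \<Omega>"
  shows "bdry_curvature \<Omega> x = curvature (abscissa x)"
proof -
  let ?n = "bdry_tangent \<Omega> x" and ?k = "curvature (abscissa x)"
  have n: "norm ?n = 1" by (simp add: bdry_tangent_eq[OF x])
  have deriv: "((\<lambda>s. bdry_tangent \<Omega> (c s)) has_vector_derivative ?k *\<^sub>R J ?n) (at 0)"
    if c: "curve_through (frontier \<Omega>) x ?n c" for c
  proof -
    obtain \<epsilon> where \<epsilon>: "\<epsilon> > 0" "c ` {-\<epsilon><..<\<epsilon>} \<subseteq> frontier \<Omega>" "c 0 = x"
        "(c has_vector_derivative ?n) (at 0)"
      using c by (auto simp: curve_through_def)
    have at0: "at (0::real) within {-\<epsilon><..<\<epsilon>} = at 0" by (rule at_within_open) (use \<epsilon>(1) in auto)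
    from bdry_tangent_derivative[of c 1 0 "{-\<epsilon><..<\<epsilon>}"] \<epsilon> x(1) show ?thesis by (simp add: at0)
  qed
  have "?n \<in> tangent_space (frontier \<Omega>) x"
    unfolding tangent_space_eq[OF x] bdry_tangent_eq[OF x] by (rule range_eqI[of _ _ 1]) simp
  then obtain c where c: "curve_through (frontier \<Omega>) x ?n c" by (auto simp: tangent_space_def)
  have "flat_connection (frontier \<Omega>) (bdry_tangent \<Omega>) x ?n = ?k *\<^sub>R J ?n"
    unfolding flat_connection_def
    by (rule the_equality) (use deriv c vector_derivative_unique_at in blast)+
  then show ?thesis using n by (simp add: bdry_curvature_def norm_eq_1)
qed

lemma curvature_continuous: "continuous_on A curvature"
proof -
  have "continuous_on A speed" unfolding speed_def by (intro continuous_intros)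
  moreover have "continuous_on A g''" using smooth(3) continuous_on_subset by blast
  ultimately show ?thesis unfolding curvature_def
    using speed_pos by (intro continuous_intros) auto
qed

lemma unit_tangent_continuous: "continuous_on A unit_tangent"
  using unit_tangent_derivative
  by (meson continuous_at_imp_continuous_on has_vector_derivative_continuous)

lemma locally_convex_at_centre:
  assumes "p \<in> frontier \<Omega>" "convex_boundary \<Omega>"
  shows "\<exists>U. open U \<and> p \<in> U \<and> convex (\<Omega> \<inter> U)"
proof -
  have p: "p \<in> ball p r" using r by simp
  have "height p = 0" using in_frontier_iff p assms(1) by blast
  then have gp0: "graph_point 0 = p" using graph_point_abscissa[of p] by (simp add: abscissa_def)
  have "continuous_on UNIV graph_point" unfolding graph_point_def by (intro continuous_intros)
  then have "open (graph_point -` ball p r)" by (simp add: open_vimage)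
  moreover have "0 \<in> graph_point -` ball p r" using gp0 p by simp
  ultimately obtain \<delta> where \<delta>: "\<delta> > 0" "ball 0 \<delta> \<subseteq> graph_point -` ball p r"
    using open_contains_ball by blast
  have "g'' s \<ge> 0" if "s \<in> ball 0 \<delta>" for s
  proof -
    have x: "graph_point s \<in> ball p r" using \<delta>(2) that by blast
    then have fr: "graph_point s \<in> frontier \<Omega>" by (simp add: in_frontier_iff)
    then have "curvature s \<ge> 0"
      using assms(2)[unfolded convex_boundary_def, rule_format, OF fr] bdry_curvature_eq[OF x fr] by simp
    then show ?thesis using speed_pos[of s] by (simp add: curvature_def zero_le_divide_iff del: speed_pos)
  qed
  then have cvx: "convex_on (ball 0 \<delta>) g"
    by (intro f''_ge0_imp_convex[OF convex_ball g' g''])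
  define U where "U = ball p (min r \<delta>)"
  have absc: "abscissa x \<in> ball 0 \<delta>" "x \<in> ball p r" if "x \<in> U" for x
  proof -
    have "\<bar>abscissa x\<bar> \<le> norm (x - p)" using Cauchy_Schwarz_ineq2[of "x - p" e] e by (simp add: abscissa_def)
    then show "abscissa x \<in> ball 0 \<delta>" using that by (simp add: U_def dist_norm norm_minus_commute)
    show "x \<in> ball p r" using that by (simp add: U_def)
  qed
  have "convex (\<Omega> \<inter> U)" unfolding convex_alt
  proof (intro ballI allI impI)
    fix x y and u :: real assume xy: "x \<in> \<Omega> \<inter> U" "y \<in> \<Omega> \<inter> U" and u: "0 \<le> u \<and> u \<le> 1"
    let ?z = "(1 - u) *\<^sub>R x + u *\<^sub>R y"
    have zU: "?z \<in> U" using xy u convex_ball[of p "min r \<delta>"] unfolding U_def convex_alt by blast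
    have zp: "?z - p = (1 - u) *\<^sub>R (x - p) + u *\<^sub>R (y - p)" by (simp add: algebra_simps)
    have "g (abscissa ?z) = g ((1 - u) *\<^sub>R abscissa x + u *\<^sub>R abscissa y)"
      unfolding abscissa_def zp by (simp add: inner_add_left)
    also have "\<dots> \<le> (1 - u) * g (abscissa x) + u * g (abscissa y)"
      using u xy absc by (intro convex_onD[OF cvx]) auto
    also have "\<dots> \<le> (1 - u) * ((x - p) \<bullet> J e) + u * ((y - p) \<bullet> J e)"
      using xy absc u by (intro add_mono mult_left_mono) (auto simp: in_domain_iff height_def)
    also have "\<dots> = (?z - p) \<bullet> J e" unfolding zp by (simp add: inner_add_left)
    finally have "0 \<le> height ?z" by (simp add: height_def)
    then show "?z \<in> \<Omega> \<inter> U" using zU absc(2)[OF zU] in_domain_iff by blast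
  qed
  then show ?thesis using r \<delta>(1) by (intro exI[of _ U]) (simp add: U_def)
qed

lemma segment_points_inward:
  assumes x: "x \<in> ball p r" "x \<in> frontier \<Omega>" and seg: "closed_segment x y \<subseteq> \<Omega>"
  shows "(y - x) \<bullet> J (bdry_tangent \<Omega> x) \<ge> 0"
proof (rule ccontr)
  define s where "s = abscissa x"
  assume "\<not> ?thesis"
  then have neg: "(y - x) \<bullet> J (unit_tangent s) < 0" by (simp add: bdry_tangent_eq[OF x] s_def)
  have h0: "height x = 0" using in_frontier_iff x by blast
  have "((\<lambda>t. x + t *\<^sub>R (y - x)) has_vector_derivative (y - x)) (at 0)"
    by (auto intro!: derivative_eq_intros)
  from height_derivative[OF this]
  have deriv: "((\<lambda>t. height (x + t *\<^sub>R (y - x))) has_real_derivative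
      (y - x) \<bullet> J e - g' s * ((y - x) \<bullet> e)) (at 0)"
    by (simp add: has_real_derivative_iff_has_vector_derivative s_def)
  have eq: "(y - x) \<bullet> J e - g' s * ((y - x) \<bullet> e) = speed s * ((y - x) \<bullet> J (unit_tangent s))"
    by (simp add: unit_tangent_def tangent_def inner_diff_right inner_add_right)
  have "speed s * ((y - x) \<bullet> J (unit_tangent s)) < 0" using neg by (simp add: mult_pos_neg)
  from DERIV_neg_dec_right[OF deriv[unfolded eq] this]
  obtain d where d: "d > 0" "\<And>t. t > 0 \<Longrightarrow> t < d \<Longrightarrow> height (x + t *\<^sub>R (y - x)) < 0"
    using h0 by auto
  have "open ((\<lambda>t. x + t *\<^sub>R (y - x)) -` ball p r)"
    by (intro open_vimage continuous_intros open_ball)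
  moreover have "0 \<in> (\<lambda>t. x + t *\<^sub>R (y - x)) -` ball p r" using x by simp
  ultimately obtain d0 where d0: "d0 > 0" "ball 0 d0 \<subseteq> (\<lambda>t. x + t *\<^sub>R (y - x)) -` ball p r"
    using open_contains_ball by blast
  define t where "t = min 1 (min d d0) / 2"
  have t: "0 < t" "t < 1" "t < d" "t \<in> ball 0 d0" using d(1) d0(1) by (auto simp: t_def)
  have "x + t *\<^sub>R (y - x) \<in> closed_segment x y"
    using t by (auto simp: closed_segment_def algebra_simps intro!: exI[of _ t])
  then have "0 \<le> height (x + t *\<^sub>R (y - x))"
    using seg in_domain_iff[of "x + t *\<^sub>R (y - x)"] d0(2) t(4) by blast
  then show False using d(2)[of t] t by simp
qed

end

lemma boundary_chart_exists:
  assumes "closed \<Omega>" "smooth_boundary \<Omega>" "p \<in> frontier \<Omega>"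
  obtains r e g g' g'' where "boundary_chart \<Omega> p e r g g' g''"
proof -
  obtain r e and g :: "real \<Rightarrow> real" where *: "r > 0" "norm e = 1" "smooth_on UNIV g"
    "\<And>x. x \<in> ball p r \<Longrightarrow> x \<in> \<Omega> \<longleftrightarrow> g ((x - p) \<bullet> e) \<le> (x - p) \<bullet> J e"
    using assms(2,3) unfolding smooth_boundary_def by blast
  obtain g' where g': "\<And>s. (g has_real_derivative g' s) (at s)" "smooth_on UNIV g'"
    using real_derivative_smooth[OF *(3)] by metis
  obtain g'' where g'': "\<And>s. (g' has_real_derivative g'' s) (at s)" "smooth_on UNIV g''"
    using real_derivative_smooth[OF g'(2)] by metis
  have "continuous_on UNIV g''" using g''(2) Ck_on_continuous unfolding smooth_on_def by blast
  then have "boundary_chart \<Omega> p e r g g' g''"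
    by unfold_locales (use assms(1) * g' g'' in auto)
  then show thesis by (rule that)
qed

locale smooth_domain =
  fixes \<Omega> :: "(real^2) set"
  assumes closed: "closed \<Omega>" and smooth_boundary: "smooth_boundary \<Omega>"
begin

abbreviation "\<Sigma> \<equiv> frontier \<Omega>"
abbreviation "\<xi> \<equiv> bdry_tangent \<Omega>"
abbreviation "\<kappa> \<equiv> bdry_curvature \<Omega>"

lemma chart:
  assumes "x \<in> \<Sigma>"
  obtains r e g g' g'' where "boundary_chart \<Omega> x e r g g' g''" "x \<in> ball x r"
proof -
  obtain r e g g' g'' where ch: "boundary_chart \<Omega> x e r g g' g''"
    by (rule boundary_chart_exists[OF closed smooth_boundary assms])
  then have "r > 0" by (simp add: boundary_chart_def)
  then show thesis using that[OF ch] by simp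
qed

lemma tangent_space_line:
  assumes "x \<in> \<Sigma>"
  shows "norm (\<xi> x) = 1" "tangent_space \<Sigma> x = range (\<lambda>a. a *\<^sub>R \<xi> x)"
proof -
  obtain r e g g' g'' where ch: "boundary_chart \<Omega> x e r g g' g''" and x: "x \<in> ball x r"
    by (rule chart[OF assms])
  interpret boundary_chart \<Omega> x e r g g' g'' by (rule ch)
  show "norm (\<xi> x) = 1" "tangent_space \<Sigma> x = range (\<lambda>a. a *\<^sub>R \<xi> x)"
    using bdry_tangent_eq[OF x assms] tangent_space_eq[OF x assms] by simp_all
qed

lemma orth_proj_tangent:
  "x \<in> \<Sigma> \<Longrightarrow> orth_proj (tangent_space \<Sigma> x) w = (w \<bullet> \<xi> x) *\<^sub>R \<xi> x"
  by (simp add: tangent_space_line orth_proj_line)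

lemma \<xi>_derivative:
  assumes c: "(c has_vector_derivative a *\<^sub>R \<xi> (c t)) (at t within I)" and t: "t \<in> I"
    and I: "c ` I \<subseteq> \<Sigma>"
  shows "((\<lambda>t. \<xi> (c t)) has_vector_derivative (a * \<kappa> (c t)) *\<^sub>R J (\<xi> (c t))) (at t within I)"
proof -
  have ct: "c t \<in> \<Sigma>" using t I by blast
  obtain r e g g' g'' where ch: "boundary_chart \<Omega> (c t) e r g g' g''" and x: "c t \<in> ball (c t) r"
    by (rule chart[OF ct])
  interpret boundary_chart \<Omega> "c t" e r g g' g'' by (rule ch)
  show ?thesis using bdry_tangent_derivative[OF c t I x] by (simp add: bdry_curvature_eq[OF x ct])
qed

lemma \<xi>_\<kappa>_continuous: "continuous_on \<Sigma> \<xi>" "continuous_on \<Sigma> \<kappa>"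
proof -
  have "continuous (at x within \<Sigma>) \<xi> \<and> continuous (at x within \<Sigma>) \<kappa>" if x: "x \<in> \<Sigma>" for x
  proof -
    obtain r e g g' g'' where ch: "boundary_chart \<Omega> x e r g g' g''" and xr: "x \<in> ball x r"
      by (rule chart[OF x])
    interpret boundary_chart \<Omega> x e r g g' g'' by (rule ch)
    have ab: "continuous_on UNIV abscissa" unfolding abscissa_def by (intro continuous_intros)
    have c1: "continuous (at x within \<Sigma>) (\<lambda>y. unit_tangent (abscissa y))"
      using continuous_on_compose2[OF unit_tangent_continuous[of UNIV] ab]
      by (simp add: continuous_on_eq_continuous_at continuous_at_imp_continuous_at_within)
    have c2: "continuous (at x within \<Sigma>) (\<lambda>y. curvature (abscissa y))"
      using continuous_on_compose2[OF curvature_continuous[of UNIV] ab]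
      by (simp add: continuous_on_eq_continuous_at continuous_at_imp_continuous_at_within)
    have near: "y \<in> ball x r" if "dist y x < r" for y using that by (simp add: dist_commute)
    show ?thesis
      using continuous_transform_within[OF c1 r x, of \<xi>] continuous_transform_within[OF c2 r x, of \<kappa>]
        bdry_tangent_eq[OF near] bdry_curvature_eq[OF near] by force
  qed
  then show "continuous_on \<Sigma> \<xi>" "continuous_on \<Sigma> \<kappa>"
    by (auto simp: continuous_on_eq_continuous_within)
qed

text \<open>A domain with nonnegative boundary curvature lies locally above the graph of a convex
  function, hence is locally convex.\<close>

lemma convex_domain:
  assumes "compact \<Omega>" "connected \<Omega>" "convex_boundary \<Omega>"
  shows "convex \<Omega>"
proof (rule locally_convex_imp_convex[OF assms(1,2)])
  fix x assume x: "x \<in> \<Omega>"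
  show "\<exists>U. open U \<and> x \<in> U \<and> convex (\<Omega> \<inter> U)"
  proof (cases "x \<in> \<Sigma>")
    case True
    obtain r e g g' g'' where ch: "boundary_chart \<Omega> x e r g g' g''"
      by (rule chart[OF True])
    show ?thesis by (rule boundary_chart.locally_convex_at_centre[OF ch True assms(3)])
  next
    case False
    then have "x \<in> interior \<Omega>" using x closed by (simp add: frontier_def)
    then obtain d where "d > 0" "ball x d \<subseteq> \<Omega>" using mem_interior by blast
    then have "convex (\<Omega> \<inter> ball x d)" by (simp add: inf.absorb2)
    then show ?thesis using \<open>d > 0\<close> by (intro exI[of _ "ball x d"]) simp
  qed
qed

lemma supporting_line:
  assumes "convex \<Omega>" "x \<in> \<Sigma>" "y \<in> \<Sigma>"
  shows "(y - x) \<bullet> J (\<xi> x) \<ge> 0"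
proof -
  obtain r e g g' g'' where ch: "boundary_chart \<Omega> x e r g g' g''" and xr: "x \<in> ball x r"
    by (rule chart[OF assms(2)])
  have "x \<in> \<Omega>" "y \<in> \<Omega>" using assms closed by (auto simp: frontier_def)
  then have "closed_segment x y \<subseteq> \<Omega>" using assms(1) convex_contains_segment by blast
  then show ?thesis by (rule boundary_chart.segment_points_inward[OF ch xr assms(2)])
qed

end

section \<open>The chord shortening flow as an ordinary differential equation\<close>

lemma norm_conormal: "x \<noteq> y \<Longrightarrow> norm (conormal x y) = 1"
  by (simp add: conormal_def)

context boundary_chart
begin

text \<open>
  The velocity of the end point \<open>x\<close> of the chord from \<open>x\<close> to \<open>y\<close>, where the boundary tangent is replaced
  by the tangent of the vertical translate of the graph through \<open>x\<close>. In this form it makes sense,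
  and is smooth, for \<open>x\<close> off the boundary as well. The inverse length and the squared normalisation
  of the tangent are written as real powers of positive smooth functions.
\<close>

definition drift :: "(real^2) \<times> (real^2) \<Rightarrow> real^2" where
  "drift z = (- (((fst z - snd z) \<bullet> tangent (abscissa (fst z)))
      * (1 + g' (abscissa (fst z)) * g' (abscissa (fst z))) powr (- 1)
      * ((fst z - snd z) \<bullet> (fst z - snd z)) powr (- (1/2)))) *\<^sub>R tangent (abscissa (fst z))"

lemma Ck_on_drift:
  assumes S: "\<And>z. z \<in> S \<Longrightarrow> fst z \<noteq> snd z"
  shows "Ck_on k drift S"
proof -
  have fst: "Ck_on k (\<lambda>z::(real^2) \<times> (real^2). fst z) S" and snd: "Ck_on k (\<lambda>z::(real^2) \<times> (real^2). snd z) S"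
    by (intro Ck_on_bounded_linear bounded_linear_fst bounded_linear_snd)+
  note diff = Ck_on_diff[OF fst snd]
  have absc: "Ck_on k (\<lambda>z. abscissa (fst z)) S"
    unfolding abscissa_def by (intro Ck_on_inner Ck_on_diff fst Ck_on_const)
  have g': "Ck_on k (\<lambda>z. g' (abscissa (fst z))) S"
    by (rule Ck_on_compose[OF _ absc]) (use smooth(2) in \<open>auto simp: smooth_on_def\<close>)
  have tan: "Ck_on k (\<lambda>z. tangent (abscissa (fst z))) S"
    unfolding tangent_def by (intro Ck_on_add Ck_on_scaleR Ck_on_const g')
  have sp: "Ck_on k (\<lambda>z. (1 + g' (abscissa (fst z)) * g' (abscissa (fst z))) powr (- 1)) S"
    by (rule Ck_on_compose[OF Ck_on_powr Ck_on_add[OF Ck_on_const Ck_on_mult[OF g' g']]])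
       (auto simp: add_pos_nonneg)
  have len: "Ck_on k (\<lambda>z. ((fst z - snd z) \<bullet> (fst z - snd z)) powr (- (1/2))) S"
    by (rule Ck_on_compose[OF Ck_on_powr Ck_on_inner[OF diff diff]]) (use S in auto)
  have "Ck_on k (\<lambda>z. 0 - ((fst z - snd z) \<bullet> tangent (abscissa (fst z)))
      * (1 + g' (abscissa (fst z)) * g' (abscissa (fst z))) powr (- 1)
      * ((fst z - snd z) \<bullet> (fst z - snd z)) powr (- (1/2))) S"
    by (intro Ck_on_diff[OF Ck_on_const] Ck_on_mult Ck_on_inner diff tan sp len)
  from Ck_on_scaleR[OF this tan] show ?thesis
    unfolding drift_def[abs_def] by simp
qed

lemma drift_eq:
  assumes "x \<in> ball p r" "x \<in> frontier \<Omega>" "x \<noteq> y"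
  shows "drift (x, y) = - (conormal x y \<bullet> bdry_tangent \<Omega> x) *\<^sub>R bdry_tangent \<Omega> x"
proof -
  define s where "s = abscissa x"
  have "((x - y) \<bullet> (x - y)) powr (- (1/2)) = inverse (norm (x - y))"
    using powr_half_sqrt[of "(x - y) \<bullet> (x - y)"]
    by (simp add: powr_minus norm_eq_sqrt_inner)
  moreover have "(1 + g' s * g' s) powr (- 1) = inverse (speed s) * inverse (speed s)"
    using speed_pos[of s] by (simp add: powr_minus speed_mult[symmetric])
  ultimately have "drift (x, y) = - (((x - y) \<bullet> tangent s) * (inverse (speed s) * inverse (speed s))
      * inverse (norm (x - y))) *\<^sub>R tangent s"
    by (simp add: drift_def s_def)
  also have "\<dots> = - (conormal x y \<bullet> unit_tangent s) *\<^sub>R unit_tangent s"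
    by (simp add: conormal_def unit_tangent_def mult_ac)
  finally show ?thesis using bdry_tangent_eq[OF assms(1,2)] by (simp add: s_def)
qed

text \<open>The drift is tangent to the vertical translates of the graph, so it preserves the height.\<close>

lemma drift_preserves_height:
  assumes "convex I" and deriv: "\<And>t. t \<in> I \<Longrightarrow> (c has_vector_derivative drift (c t, d t)) (at t within I)"
    and "t \<in> I" "u \<in> I"
  shows "height (c t) = height (c u)"
proof -
  have "((\<lambda>t. height (c t)) has_vector_derivative 0) (at t within I)" if "t \<in> I" for t
  proof -
    have "\<exists>a. drift z = a *\<^sub>R tangent (abscissa (fst z))" for z
      unfolding drift_def by (rule exI) (rule refl)
    from this[of "(c t, d t)"] obtain a where a: "drift (c t, d t) = a *\<^sub>R tangent (abscissa (c t))"
      by auto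
    from height_derivative[OF deriv[OF that]] show ?thesis
      by (simp add: a tangent_def inner_add_left)
  qed
  then obtain h where "\<And>t. t \<in> I \<Longrightarrow> height (c t) = h"
    using has_vector_derivative_zero_constant[OF assms(1), of "\<lambda>t. height (c t)"] by blast
  then show ?thesis using assms(3,4) by simp
qed

end

context smooth_domain
begin

definition velocity :: "real^2 \<Rightarrow> real^2 \<Rightarrow> real^2" where
  "velocity x y = - (conormal x y \<bullet> \<xi> x) *\<^sub>R \<xi> x"

definition chord_field :: "(real^2) \<times> (real^2) \<Rightarrow> (real^2) \<times> (real^2)" where
  "chord_field z = (velocity (fst z) (snd z), velocity (snd z) (fst z))"

definition chords :: "((real^2) \<times> (real^2)) set" where
  "chords = {z. fst z \<in> \<Sigma> \<and> snd z \<in> \<Sigma> \<and> fst z \<noteq> snd z}"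

definition chord_ode :: "(real \<Rightarrow> (real^2) \<times> (real^2)) \<Rightarrow> real set \<Rightarrow> bool" where
  "chord_ode Y I \<longleftrightarrow> (\<forall>t\<in>I. Y t \<in> chords \<and> (Y has_vector_derivative chord_field (Y t)) (at t within I))"

lemma chord_odeD:
  assumes "chord_ode Y I" "t \<in> I"
  shows "Y t \<in> chords" "(Y has_vector_derivative chord_field (Y t)) (at t within I)"
  using assms by (auto simp: chord_ode_def)

lemma chord_ode_subset: "chord_ode Y I \<Longrightarrow> K \<subseteq> I \<Longrightarrow> chord_ode Y K"
  unfolding chord_ode_def using has_vector_derivative_within_subset by blast

lemma chord_ode_cong:
  assumes Y: "chord_ode Y I" and eq: "\<And>t. t \<in> I \<Longrightarrow> Z t = Y t"
  shows "chord_ode Z I"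
  unfolding chord_ode_def
proof
  fix t assume t: "t \<in> I"
  show "Z t \<in> chords \<and> (Z has_vector_derivative chord_field (Z t)) (at t within I)"
    using has_vector_derivative_transform[OF t eq chord_odeD(2)[OF Y t]] chord_odeD(1)[OF Y t] eq[OF t]
    by simp
qed

lemma chord_ode_continuous: "chord_ode Y I \<Longrightarrow> continuous_on I Y"
  using chord_odeD(2) has_vector_derivative_continuous continuous_on_eq_continuous_within by blast

lemma norm_velocity: "x \<in> \<Sigma> \<Longrightarrow> x \<noteq> y \<Longrightarrow> norm (velocity x y) \<le> 1"
  using Cauchy_Schwarz_ineq2[of "conormal x y" "\<xi> x"] tangent_space_line(1)[of x]
  by (simp add: velocity_def norm_conormal)

lemma norm_chord_field: "z \<in> chords \<Longrightarrow> norm (chord_field z) \<le> 2"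
  using norm_velocity[of "fst z" "snd z"] norm_velocity[of "snd z" "fst z"]
    norm_Pair_le[of "velocity (fst z) (snd z)" "velocity (snd z) (fst z)"]
  by (auto simp: chord_field_def chords_def)

lemma continuous_on_chord_field: "continuous_on chords chord_field"
proof -
  have x: "continuous_on chords (\<lambda>z. \<xi> (fst z))" "continuous_on chords (\<lambda>z. \<xi> (snd z))"
    by (rule continuous_on_compose2[OF \<xi>_\<kappa>_continuous(1)], auto intro!: continuous_intros simp: chords_def)+
  show ?thesis
    unfolding chord_field_def velocity_def conormal_def
    by (intro continuous_intros x) (auto simp: chords_def)
qed

text \<open>The vector field is extended by the drifts in two charts, one around each end point. As the
  drifts preserve the heights, which vanish on the boundary, solutions cannot leave it.\<close>

lemma smooth_chord_field_extension:
  assumes "z0 \<in> chords"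
  obtains U F where "open U" "z0 \<in> U" "smooth_on U F"
    and "\<And>z. z \<in> U \<Longrightarrow> z \<in> chords \<Longrightarrow> F z = chord_field z"
    and "\<And>Y I. Y ` I \<subseteq> U \<Longrightarrow> convex I \<Longrightarrow> 0 \<in> I \<Longrightarrow> Y 0 \<in> chords \<Longrightarrow>
      (\<And>t. t \<in> I \<Longrightarrow> (Y has_vector_derivative F (Y t)) (at t within I)) \<Longrightarrow> Y ` I \<subseteq> chords"
proof -
  obtain a b where z0: "z0 = (a, b)" by (cases z0)
  with assms have ab: "a \<in> \<Sigma>" "b \<in> \<Sigma>" "a \<noteq> b" by (auto simp: chords_def)
  obtain ra ea ga ga' ga'' where cha: "boundary_chart \<Omega> a ea ra ga ga' ga''" and a: "a \<in> ball a ra"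
    by (rule chart[OF ab(1)])
  obtain rb eb gb gb' gb'' where chb: "boundary_chart \<Omega> b eb rb gb gb' gb''" and b: "b \<in> ball b rb"
    by (rule chart[OF ab(2)])
  interpret A: boundary_chart \<Omega> a ea ra ga ga' ga'' by (rule cha)
  interpret B: boundary_chart \<Omega> b eb rb gb gb' gb'' by (rule chb)
  define U where "U = ball a ra \<times> ball b rb \<inter> {z. fst z \<noteq> snd z}"
  define F where "F z = (A.drift z, B.drift (snd z, fst z))" for z
  have U: "fst z \<in> ball a ra" "snd z \<in> ball b rb" "fst z \<noteq> snd z" if "z \<in> U" for z
    using that by (auto simp: U_def)
  show thesis
  proof (rule that[of U F])
    show "open U" unfolding U_def
      by (intro open_Int open_Times open_ball open_Collect_neq continuous_intros)
    show "z0 \<in> U" using a b ab by (simp add: U_def z0)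
    show "smooth_on U F" unfolding smooth_on_def
    proof
      fix k
      have sw: "Ck_on k (\<lambda>z::(real^2) \<times> (real^2). (snd z, fst z)) U"
        by (intro Ck_on_bounded_linear bounded_linear_Pair bounded_linear_fst bounded_linear_snd)
      have sub: "(\<lambda>z. (snd z, fst z)) ` U \<subseteq> {z. fst z \<noteq> snd z}"
      proof (rule image_subsetI)
        fix z assume "z \<in> U"
        from U(3)[OF this] show "(snd z, fst z) \<in> {z. fst z \<noteq> snd z}" by simp
      qed
      have "Ck_on k (\<lambda>z. B.drift (snd z, fst z)) U"
        by (rule Ck_on_compose[OF B.Ck_on_drift sw sub]) simp
      then show "Ck_on k F U" unfolding F_def[abs_def]
        by (intro Ck_on_Pair A.Ck_on_drift U(3))
    qed
    show "F z = chord_field z" if "z \<in> U" "z \<in> chords" for z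
      using A.drift_eq[of "fst z" "snd z"] B.drift_eq[of "snd z" "fst z"] U[OF that(1)] that(2)
      by (simp add: F_def chord_field_def velocity_def chords_def)
    fix Y I assume YU: "Y ` I \<subseteq> U" and I: "convex I" "(0::real) \<in> I" and Y0: "Y 0 \<in> chords"
      and ode: "\<And>t. t \<in> I \<Longrightarrow> (Y has_vector_derivative F (Y t)) (at t within I)"
    have YUt: "Y t \<in> U" if "t \<in> I" for t using YU that by blast
    have d1: "((\<lambda>t. fst (Y t)) has_vector_derivative A.drift (fst (Y t), snd (Y t))) (at t within I)" if "t \<in> I" for t
      using bounded_linear.has_vector_derivative[OF bounded_linear_fst ode[OF that]] by (simp add: F_def)
    have d2: "((\<lambda>t. snd (Y t)) has_vector_derivative B.drift (snd (Y t), fst (Y t))) (at t within I)" if "t \<in> I" for t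
      using bounded_linear.has_vector_derivative[OF bounded_linear_snd ode[OF that]] by (simp add: F_def)
    show "Y ` I \<subseteq> chords"
    proof
      fix z assume "z \<in> Y ` I"
      then obtain t where t: "t \<in> I" "z = Y t" by blast
      have "A.height (fst z) = 0"
        using A.drift_preserves_height[OF I(1) d1 t(1) I(2)] A.in_frontier_iff[OF U(1)[OF YUt[OF I(2)]]] Y0
        by (simp add: t(2) chords_def)
      moreover have "B.height (snd z) = 0"
        using B.drift_preserves_height[OF I(1) d2 t(1) I(2)] B.in_frontier_iff[OF U(2)[OF YUt[OF I(2)]]] Y0
        by (simp add: t(2) chords_def)
      ultimately show "z \<in> chords"
        using U[OF YUt[OF t(1)]] A.in_frontier_iff B.in_frontier_iff by (simp add: chords_def t(2))
    qed
  qed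
qed

lemma chord_ode_smooth:
  assumes Y: "chord_ode Y I" and I: "\<And>t. t \<in> I \<Longrightarrow> t islimpt I"
  shows "Ck_on k Y I"
proof (rule Ck_on_interval_local[OF I])
  fix t assume t: "t \<in> I"
  obtain U F where UF: "open U" "Y t \<in> U" "smooth_on U F"
    "\<And>z. z \<in> U \<Longrightarrow> z \<in> chords \<Longrightarrow> F z = chord_field z"
    using smooth_chord_field_extension[OF chord_odeD(1)[OF Y t]] by metis
  obtain V where V: "open V" "V \<inter> I = Y -` U \<inter> I"
    using continuous_on_open_invariant[THEN iffD1, OF chord_ode_continuous[OF Y], rule_format, OF UF(1)]
    by blast
  have YV: "Y s \<in> U" if "s \<in> I \<inter> V" for s using V(2) that by blast
  have "Ck_on k Y (I \<inter> V)"
  proof (rule ode_solution_smooth[OF UF(3)])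
    show "Y ` (I \<inter> V) \<subseteq> U" using YV by blast
    fix s assume s: "s \<in> I \<inter> V"
    then have "(Y has_vector_derivative chord_field (Y s)) (at s within (I \<inter> V))"
      using chord_odeD(2)[OF Y, of s] has_vector_derivative_within_subset[of Y _ s I "I \<inter> V"] by blast
    then show "(Y has_vector_derivative F (Y s)) (at s within (I \<inter> V))"
      using UF(4)[OF YV[OF s]] chord_odeD(1)[OF Y, of s] s by simp
  qed
  then show "\<exists>U. open U \<and> t \<in> U \<and> Ck_on k Y (I \<inter> U)" using V UF(2) t by blast
qed

lemma chord_ode_local_solution:
  assumes "z0 \<in> chords"
  obtains \<epsilon> Y where "\<epsilon> > 0" "Y 0 = z0" "chord_ode Y {0..\<epsilon>}"
proof -
  obtain U F where U: "open U" "z0 \<in> U" "smooth_on U F"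
    and F: "\<And>z. z \<in> U \<Longrightarrow> z \<in> chords \<Longrightarrow> F z = chord_field z"
    and inv: "\<And>Y I. Y ` I \<subseteq> U \<Longrightarrow> convex I \<Longrightarrow> 0 \<in> I \<Longrightarrow> Y 0 \<in> chords \<Longrightarrow>
      (\<And>t. t \<in> I \<Longrightarrow> (Y has_vector_derivative F (Y t)) (at t within I)) \<Longrightarrow> Y ` I \<subseteq> chords"
    using smooth_chord_field_extension[OF assms] by metis
  have "Ck_on 1 F U" using U(3) unfolding smooth_on_def by blast
  then obtain \<epsilon> Y where Y: "\<epsilon> > 0" "Y 0 = z0" "Y ` {0..\<epsilon>} \<subseteq> U"
    "\<And>t. t \<in> {0..\<epsilon>} \<Longrightarrow> (Y has_vector_derivative F (Y t)) (at t within {0..\<epsilon>})"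
    using ode_local_solution[OF U(1,2)] by metis
  have "Y ` {0..\<epsilon>} \<subseteq> chords"
    by (rule inv) (use Y assms in auto)
  then have "chord_ode Y {0..\<epsilon>}"
    unfolding chord_ode_def using Y(3,4) F by (metis image_subset_iff)
  then show thesis using that Y(1,2) by blast
qed

text \<open>The speed is bounded, so solutions are Lipschitz continuous and have a limit at the end of a
  bounded time interval.\<close>

lemma chord_ode_limit:
  assumes Y: "chord_ode Y {0..<T}" and "0 < T"
  obtains z where "(Y \<longlongrightarrow> z) (at_left T)" "fst z \<in> \<Sigma>" "snd z \<in> \<Sigma>"
proof -
  have "norm (Y s - Y t) \<le> 2 * norm (s - t)" if "s \<in> {0..<T}" "t \<in> {0..<T}" for s t
  proof (rule differentiable_bound[OF _ _ _ that])
    show "convex {0..<T}" by simp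
    show "(Y has_derivative (\<lambda>h. h *\<^sub>R chord_field (Y u))) (at u within {0..<T})" if "u \<in> {0..<T}" for u
      using chord_odeD(2)[OF Y that] by (simp add: has_vector_derivative_def)
    show "onorm (\<lambda>h. h *\<^sub>R chord_field (Y u)) \<le> 2" if "u \<in> {0..<T}" for u
    proof (rule onorm_le)
      show "norm (h *\<^sub>R chord_field (Y u)) \<le> 2 * norm h" for h
        using mult_left_mono[OF norm_chord_field[OF chord_odeD(1)[OF Y that]], of "\<bar>h\<bar>"]
        by (simp add: mult.commute)
    qed
  qed
  then have "2-lipschitz_on {0..<T} Y" by (auto intro!: lipschitz_onI simp: dist_norm)
  then have uc: "uniformly_continuous_on {0..<T} Y" by (rule lipschitz_on_uniformly_continuous)
  have "T \<in> closure {0..<T}" using assms(2) by simp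
  from uniformly_continuous_on_extension_at_closure[OF uc this]
  obtain z where z: "(Y \<longlongrightarrow> z) (at T within {0..<T})" .
  have atl: "at T within {0..<T} = at_left T"
    by (rule at_within_nhd[of T "{0<..}"]) (use assms(2) in auto)
  have nb: "at_left T \<noteq> bot" by simp
  have ev: "\<forall>\<^sub>F t in at_left T. t \<in> {0..<T}"
    using assms(2) unfolding eventually_at_left_field by (intro exI[of _ 0]) auto
  have lim: "(Y \<longlongrightarrow> z) (at_left T)" using z atl by simp
  have "fst z \<in> \<Sigma>"
    by (rule Lim_in_closed_set[OF frontier_closed _ nb tendsto_fst[OF lim]])
       (use ev chord_odeD(1)[OF Y] in \<open>auto simp: chords_def elim!: eventually_mono\<close>)
  moreover have "snd z \<in> \<Sigma>"
    by (rule Lim_in_closed_set[OF frontier_closed _ nb tendsto_snd[OF lim]])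
       (use ev chord_odeD(1)[OF Y] in \<open>auto simp: chords_def elim!: eventually_mono\<close>)
  ultimately show thesis using that lim by blast
qed

text \<open>
  The solution starting from the limiting chord is attached; the two pieces fit together to a
  differentiable curve because the derivative, being \<open>chord_field\<close> of a continuous curve, extends
  continuously across the junction.
\<close>

lemma chord_ode_continuation:
  assumes Y: "chord_ode Y {0..<T}" and T: "0 < T"
    and lim: "(Y \<longlongrightarrow> z) (at_left T)" and z: "z \<in> chords"
  obtains T' Y' where "T < T'" "chord_ode Y' {0..<T'}" "\<And>t. t \<in> {0..<T} \<Longrightarrow> Y' t = Y t"
proof -
  obtain \<delta> R where R: "\<delta> > 0" "R 0 = z" "chord_ode R {0..\<delta>}"
    by (rule chord_ode_local_solution[OF z])
  define Y' where "Y' t = (if t < T then Y t else R (t - T))" for t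
  have c1: "continuous_on {0..T} Y'"
    unfolding continuous_on_eq_continuous_within continuous_within
  proof
    fix t assume t: "t \<in> {0..T}"
    show "(Y' \<longlongrightarrow> Y' t) (at t within {0..T})"
    proof (cases "t < T")
      case True
      have "continuous_on {0..<T} Y'"
        by (rule continuous_on_eq[OF chord_ode_continuous[OF Y]]) (simp add: Y'_def)
      then have "(Y' \<longlongrightarrow> Y' t) (at t within {0..<T})"
        using t True by (auto simp: continuous_on_def)
      moreover have "at t within {0..<T} = at t within {0..T}"
        by (rule at_within_nhd[of t "{..<T}"]) (use t True in auto)
      ultimately show ?thesis by simp
    next
      case False
      then have tT: "t = T" using t by simp
      have "(Y' \<longlongrightarrow> z) (at_left T)"
        by (rule Lim_transform_eventually[OF lim]) (simp add: eventually_at_filter Y'_def)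
      then show ?thesis using at_within_Icc_at_left[OF T] by (simp add: tT Y'_def R(2))
    qed
  qed
  have "continuous_on {T..T+\<delta>} (\<lambda>t. R (t - T))"
    by (rule continuous_on_compose2[OF chord_ode_continuous[OF R(3)]]) (auto intro!: continuous_intros)
  then have c2: "continuous_on {T..T+\<delta>} Y'"
    by (rule continuous_on_eq) (simp add: Y'_def)
  have "{0..T+\<delta>} = {0..T} \<union> {T..T+\<delta>}" using T R(1) by auto
  then have cont: "continuous_on {0..T+\<delta>} Y'"
    using continuous_on_closed_Un[OF closed_atLeastAtMost closed_atLeastAtMost c1 c2] by simp
  have chords: "Y' t \<in> chords" if "t \<in> {0..T+\<delta>}" for t
    using that chord_odeD(1)[OF Y, of t] chord_odeD(1)[OF R(3), of "t - T"] by (auto simp: Y'_def)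
  have contW: "continuous_on {0..T+\<delta>} (\<lambda>t. chord_field (Y' t))"
    by (rule continuous_on_compose2[OF continuous_on_chord_field cont]) (use chords in blast)
  have deriv: "(Y' has_vector_derivative chord_field (Y' t)) (at t)" if t: "t \<in> {0<..<T+\<delta>} - {T}" for t
  proof (cases "t < T")
    case True
    have "t \<in> interior {0..<T}" using t True by (simp add: interior_atLeastLessThan)
    then have "(Y has_vector_derivative chord_field (Y t)) (at t)"
      using chord_odeD(2)[OF Y, of t] t True at_within_interior[of t "{0..<T}"] by simp
    then have "(Y' has_vector_derivative chord_field (Y t)) (at t)"
      by (rule has_vector_derivative_transform_within_open[of _ _ _ "{..<T}"]) (use True in \<open>auto simp: Y'_def\<close>)
    then show ?thesis using True by (simp add: Y'_def)
  next
    case False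
    define s where "s = t - T"
    have s: "s \<in> {0<..<\<delta>}" using t False by (auto simp: s_def)
    then have "s \<in> interior {0..\<delta>}" by simp
    then have "(R has_vector_derivative chord_field (R s)) (at s)"
      using chord_odeD(2)[OF R(3), of s] s at_within_interior[of s "{0..\<delta>}"] by simp
    moreover have "((\<lambda>t. t - T) has_vector_derivative 1) (at t)"
      by (auto intro!: derivative_eq_intros)
    ultimately have "(R \<circ> (\<lambda>t. t - T) has_vector_derivative chord_field (R s)) (at t)"
      using vector_diff_chain_at[of "\<lambda>t. t - T" 1 t R] by (simp add: s_def)
    then have "(Y' has_vector_derivative chord_field (R s)) (at t)"
      by (rule has_vector_derivative_transform_within_open[of _ _ _ "{T<..}"])
         (use t False in \<open>auto simp: Y'_def\<close>)
    then show ?thesis using False by (simp add: Y'_def s_def)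
  qed
  have "chord_ode Y' {0..T+\<delta>}" unfolding chord_ode_def
    using chords has_vector_derivative_across_exceptions[OF _ cont contW deriv] by blast
  then have "chord_ode Y' {0..<T+\<delta>}" by (rule chord_ode_subset) auto
  then show thesis using that[of "T + \<delta>" Y'] R(1) by (simp add: Y'_def)
qed

section \<open>Maximal solutions\<close>

lemma time_interval_ereal [simp]: "time_interval (ereal T) = {0..<T}"
  by (auto simp: time_interval_def)

lemma time_interval_mono: "S \<le> T \<Longrightarrow> time_interval S \<subseteq> time_interval T"
  by (auto simp: time_interval_def intro: less_le_trans)

lemma time_interval_strict_mono:
  assumes "0 < S" "S < T"
  shows "time_interval S \<subset> time_interval T"
proof -
  obtain s where s: "S = ereal s" using assms by (cases S) auto
  then have "s \<in> time_interval T" "s \<notin> time_interval S"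
    using assms by (auto simp: time_interval_def zero_ereal_def)
  moreover have "time_interval S \<subseteq> time_interval T"
    using assms(2) by (intro time_interval_mono) simp
  ultimately show ?thesis by blast
qed

lemma at_within_time_interval:
  assumes "S \<le> T" "t \<in> time_interval S"
  shows "at t within time_interval T = at t within time_interval S"
proof (rule at_within_nhd[of t "ereal -` {..<S}"])
  show "t \<in> ereal -` {..<S}" using assms(2) by (simp add: time_interval_def)
  show "open (ereal -` {..<S})" by (intro open_ereal_vimage open_lessThan)
  show "time_interval T \<inter> ereal -` {..<S} - {t} = time_interval S \<inter> ereal -` {..<S} - {t}"
    using assms(1) by (auto simp: time_interval_def)
qed

lemma time_interval_islimpt:
  assumes "0 < T" "t \<in> time_interval T"
  shows "t islimpt time_interval T"
proof -
  obtain u where u: "ereal t < ereal u" "ereal u < T"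
    using assms(2) ereal_dense2[of "ereal t" T] by (auto simp: time_interval_def)
  have "t islimpt {t..<u}"
    using u(1) by (simp add: islimpt_Ico)
  moreover have "{t..<u} \<subseteq> time_interval T"
  proof
    fix s assume s: "s \<in> {t..<u}"
    then have "ereal s < T" using less_trans[OF _ u(2), of "ereal s"] by simp
    then show "s \<in> time_interval T" using s assms(2) by (simp add: time_interval_def)
  qed
  ultimately show ?thesis by (rule islimpt_subset)
qed

text \<open>Zorn's lemma is applied to the graphs of solutions with initial value \<open>z0\<close>, ordered by inclusion:
  the union of a chain is again the graph of a solution, as derivatives are local, and a proper
  extension of a solution has a strictly larger graph.\<close>

theorem maximal_chord_ode:
  assumes z0: "z0 \<in> chords"
  obtains Y T where "0 < T" "chord_ode Y (time_interval T)" "Y 0 = z0"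
    and "\<And>Y' T'. T < T' \<Longrightarrow> chord_ode Y' (time_interval T') \<Longrightarrow>
      (\<And>t. t \<in> time_interval T \<Longrightarrow> Y' t = Y t) \<Longrightarrow> False"
proof -
  define gr where "gr Y T = (\<lambda>t. (t, Y t)) ` time_interval T"
    for Y :: "real \<Rightarrow> (real^2) \<times> (real^2)" and T
  define sol where "sol Y T \<longleftrightarrow> 0 < T \<and> chord_ode Y (time_interval T) \<and> Y 0 = z0" for Y T
  define \<A> where "\<A> = {G. \<exists>Y T. sol Y T \<and> G = gr Y T}"
  have "\<exists>M\<in>\<A>. \<forall>X\<in>\<A>. M \<subseteq> X \<longrightarrow> X = M"
  proof (rule subset_Zorn_nonempty)
    obtain \<epsilon> Y where Y: "\<epsilon> > 0" "Y 0 = z0" "chord_ode Y {0..\<epsilon>}"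
      by (rule chord_ode_local_solution[OF z0])
    have "chord_ode Y (time_interval (ereal \<epsilon>))"
      unfolding time_interval_ereal using Y(3) by (rule chord_ode_subset) auto
    then have "sol Y (ereal \<epsilon>)" using Y by (simp add: sol_def)
    then show "\<A> \<noteq> {}" by (auto simp: \<A>_def)
  next
    fix \<C> assume ne: "\<C> \<noteq> {}" and ch: "subset.chain \<A> \<C>"
    have "\<forall>G\<in>\<C>. \<exists>Y T. sol Y T \<and> G = gr Y T"
      using ch by (auto simp: subset.chain_def \<A>_def)
    then obtain YG TG where *: "\<And>G. G \<in> \<C> \<Longrightarrow> sol (YG G) (TG G) \<and> G = gr (YG G) (TG G)"
      by metis
    define T where "T = Sup (TG ` \<C>)"
    define Y where "Y t = (SOME y. (t, y) \<in> \<Union>\<C>)" for t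
    have TG_le: "TG G \<le> T" if "G \<in> \<C>" for G
      unfolding T_def using that by (intro Sup_upper) auto
    \<comment> \<open>Any two graphs in the chain are comparable, so their union is the graph of a function.\<close>
    have funct: "y = y'" if "(t, y) \<in> \<Union>\<C>" "(t, y') \<in> \<Union>\<C>" for t y y'
    proof -
      from that obtain G G' where GG: "G \<in> \<C>" "G' \<in> \<C>" "(t, y) \<in> G" "(t, y') \<in> G'" by blast
      then have "G \<subseteq> G' \<or> G' \<subseteq> G" using ch by (auto simp: subset.chain_def)
      then obtain H where H: "H \<in> \<C>" "(t, y) \<in> H" "(t, y') \<in> H" using GG by blast
      have "H = (\<lambda>t. (t, YG H t)) ` time_interval (TG H)" using *[OF H(1)] by (simp add: gr_def)
      then have "y = YG H t" "y' = YG H t" using H(2,3) by blast+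
      then show ?thesis by simp
    qed
    have YG: "Y t = YG G t" if "G \<in> \<C>" "t \<in> time_interval (TG G)" for G t
    proof -
      have "(t, YG G t) \<in> gr (YG G) (TG G)" using that(2) by (auto simp: gr_def)
      then have mem: "(t, YG G t) \<in> \<Union>\<C>" using *[OF that(1)] that(1) by blast
      then have "(t, Y t) \<in> \<Union>\<C>" unfolding Y_def by (rule someI)
      then show ?thesis by (rule funct[OF _ mem])
    qed
    have cover: "\<exists>G\<in>\<C>. t \<in> time_interval (TG G)" if "t \<in> time_interval T" for t
      using that unfolding T_def time_interval_def by (auto simp: less_SUP_iff)
    obtain G0 where G0: "G0 \<in> \<C>" using ne by blast
    have "0 < T" using *[OF G0] TG_le[OF G0] by (auto simp: sol_def)
    have "0 \<in> time_interval (TG G0)"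
      using *[OF G0] by (simp add: sol_def time_interval_def zero_ereal_def[symmetric])
    then have "Y 0 = z0" using YG[OF G0] *[OF G0] by (simp add: sol_def)
    moreover have "chord_ode Y (time_interval T)" unfolding chord_ode_def
    proof
      fix t assume t: "t \<in> time_interval T"
      then obtain G where G: "G \<in> \<C>" "t \<in> time_interval (TG G)" using cover by blast
      have "chord_ode (YG G) (time_interval (TG G))" using *[OF G(1)] by (simp add: sol_def)
      then have "chord_ode Y (time_interval (TG G))"
        by (rule chord_ode_cong) (use YG[OF G(1)] in simp)
      from chord_odeD[OF this G(2)]
      show "Y t \<in> chords \<and> (Y has_vector_derivative chord_field (Y t)) (at t within time_interval T)"
        using at_within_time_interval[OF TG_le[OF G(1)] G(2)] by simp
    qed
    ultimately have "sol Y T" using \<open>0 < T\<close> by (simp add: sol_def)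
    moreover have "\<Union>\<C> = gr Y T"
    proof (intro equalityI subsetI)
      fix x assume "x \<in> \<Union>\<C>"
      then obtain G where G: "G \<in> \<C>" "x \<in> G" by blast
      then obtain t where t: "t \<in> time_interval (TG G)" "x = (t, YG G t)"
        using *[OF G(1)] by (auto simp: gr_def)
      then show "x \<in> gr Y T" using YG[OF G(1) t(1)] time_interval_mono[OF TG_le[OF G(1)]]
        by (auto simp: gr_def)
    next
      fix x assume "x \<in> gr Y T"
      then obtain t where t: "t \<in> time_interval T" "x = (t, Y t)" by (auto simp: gr_def)
      then obtain G where G: "G \<in> \<C>" "t \<in> time_interval (TG G)" using cover by blast
      then have "x \<in> gr (YG G) (TG G)" using YG[OF G] t by (auto simp: gr_def)
      then show "x \<in> \<Union>\<C>" using *[OF G(1)] G(1) by blast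
    qed
    ultimately show "\<Union>\<C> \<in> \<A>" by (auto simp: \<A>_def)
  qed
  then obtain Y T where Y: "sol Y T" and max: "\<And>X. X \<in> \<A> \<Longrightarrow> gr Y T \<subseteq> X \<Longrightarrow> X = gr Y T"
    by (auto simp: \<A>_def)
  show thesis
  proof (rule that[of T Y])
    show "0 < T" "chord_ode Y (time_interval T)" "Y 0 = z0" using Y by (auto simp: sol_def)
    fix Y' T' assume T': "T < T'" and ode: "chord_ode Y' (time_interval T')"
      and eq: "\<And>t. t \<in> time_interval T \<Longrightarrow> Y' t = Y t"
    have sub: "time_interval T \<subset> time_interval T'"
      by (rule time_interval_strict_mono[OF \<open>0 < T\<close> T'])
    have "0 \<in> time_interval T" using \<open>0 < T\<close> by (simp add: time_interval_def zero_ereal_def[symmetric])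
    then have "Y' 0 = z0" using eq Y by (simp add: sol_def)
    moreover have "0 < T'" using \<open>0 < T\<close> T' by (rule less_trans)
    ultimately have "gr Y' T' \<in> \<A>" using ode by (auto simp: \<A>_def sol_def)
    moreover have "gr Y T \<subseteq> gr Y' T'" using eq sub by (auto simp: gr_def intro!: image_eqI)
    ultimately have "gr Y' T' = gr Y T" by (rule max)
    then have "fst ` gr Y' T' = fst ` gr Y T" by simp
    then show False using sub by (simp add: gr_def image_image)
  qed
qed

section \<open>Flows as solutions\<close>

lemma flow_imp_chord_ode:
  assumes "chord_shortening_flow \<Sigma> C T"
  shows "0 < T" "chord_ode (\<lambda>t. (C 0 t, C 1 t)) (time_interval T)"
    and "\<And>u t. t \<in> time_interval T \<Longrightarrow> u \<in> {0..1} \<Longrightarrow> C u t = linepath (C 0 t) (C 1 t) u"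
proof -
  note flow = assms[unfolded chord_shortening_flow_def]
  show "0 < T" using flow by blast
  show "C u t = linepath (C 0 t) (C 1 t) u" if "t \<in> time_interval T" "u \<in> {0..1}" for u t
    using flow that by blast
  show "chord_ode (\<lambda>t. (C 0 t, C 1 t)) (time_interval T)"
    unfolding chord_ode_def
  proof
    fix t assume "t \<in> time_interval T"
    with flow have *: "C 0 t \<in> \<Sigma>" "C 1 t \<in> \<Sigma>" "C 0 t \<noteq> C 1 t"
      "((\<lambda>s. C 0 s) has_vector_derivative
         - orth_proj (tangent_space \<Sigma> (C 0 t)) (conormal (C 0 t) (C 1 t))) (at t within time_interval T)"
      "((\<lambda>s. C 1 s) has_vector_derivative
         - orth_proj (tangent_space \<Sigma> (C 1 t)) (conormal (C 1 t) (C 0 t))) (at t within time_interval T)"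
      by blast+
    from has_vector_derivative_Pair[OF *(4,5)]
    show "(C 0 t, C 1 t) \<in> chords \<and> ((\<lambda>t. (C 0 t, C 1 t)) has_vector_derivative
        chord_field (C 0 t, C 1 t)) (at t within time_interval T)"
      using *(1-3) by (simp add: chords_def chord_field_def velocity_def orth_proj_tangent)
  qed
qed

lemma chord_ode_imp_flow:
  assumes T: "0 < T" and Y: "chord_ode Y (time_interval T)"
  shows "chord_shortening_flow \<Sigma> (\<lambda>u t. linepath (fst (Y t)) (snd (Y t)) u) T"
  unfolding chord_shortening_flow_def
proof (intro conjI ballI T)
  let ?S = "{0..1::real} \<times> time_interval T"
  show "smooth_on ?S (\<lambda>(u, t). linepath (fst (Y t)) (snd (Y t)) u)"
    unfolding smooth_on_def
  proof
    fix k
    have Yk: "Ck_on k Y (time_interval T)"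
      by (rule chord_ode_smooth[OF Y time_interval_islimpt[OF T]])
    have snd: "Ck_on k (\<lambda>x::real \<times> real. snd x) ?S" and fst: "Ck_on k (\<lambda>x::real \<times> real. fst x) ?S"
      by (intro Ck_on_bounded_linear bounded_linear_fst bounded_linear_snd)+
    have Y2: "Ck_on k (\<lambda>x. Y (snd x)) ?S"
      by (rule Ck_on_compose[OF Yk snd]) auto
    have "Ck_on k (\<lambda>x. (1 - fst x) *\<^sub>R fst (Y (snd x)) + fst x *\<^sub>R snd (Y (snd x))) ?S"
      by (intro Ck_on_add Ck_on_scaleR Ck_on_diff Ck_on_const fst Ck_on_fst[OF Y2] Ck_on_snd[OF Y2])
    then show "Ck_on k (\<lambda>(u, t). linepath (fst (Y t)) (snd (Y t)) u) ?S"
      by (simp add: linepath_def case_prod_unfold)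
  qed
  fix t assume t: "t \<in> time_interval T"
  note Yt = chord_odeD[OF Y t]
  show "linepath (fst (Y t)) (snd (Y t)) 0 \<in> \<Sigma>" "linepath (fst (Y t)) (snd (Y t)) 1 \<in> \<Sigma>"
    "linepath (fst (Y t)) (snd (Y t)) 0 \<noteq> linepath (fst (Y t)) (snd (Y t)) 1"
    using Yt(1) by (auto simp: chords_def linepath_0' linepath_1')
  show "linepath (fst (Y t)) (snd (Y t)) u = linepath (linepath (fst (Y t)) (snd (Y t)) 0) (linepath (fst (Y t)) (snd (Y t)) 1) u" for u
    by (simp add: linepath_0' linepath_1')
  show "((\<lambda>s. linepath (fst (Y s)) (snd (Y s)) 0) has_vector_derivative
      - orth_proj (tangent_space \<Sigma> (linepath (fst (Y t)) (snd (Y t)) 0))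
          (conormal (linepath (fst (Y t)) (snd (Y t)) 0) (linepath (fst (Y t)) (snd (Y t)) 1))) (at t within time_interval T)"
    using bounded_linear.has_vector_derivative[OF bounded_linear_fst Yt(2)] Yt(1)
    by (simp add: linepath_0' linepath_1' orth_proj_tangent chords_def chord_field_def velocity_def)
  show "((\<lambda>s. linepath (fst (Y s)) (snd (Y s)) 1) has_vector_derivative
      - orth_proj (tangent_space \<Sigma> (linepath (fst (Y t)) (snd (Y t)) 1))
          (conormal (linepath (fst (Y t)) (snd (Y t)) 1) (linepath (fst (Y t)) (snd (Y t)) 0))) (at t within time_interval T)"
    using bounded_linear.has_vector_derivative[OF bounded_linear_snd Yt(2)] Yt(1)
    by (simp add: linepath_0' linepath_1' orth_proj_tangent chords_def chord_field_def velocity_def)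
qed

end

section \<open>Cooperative linear systems\<close>

lemma nonincreasing_from_derivative:
  fixes f :: "real \<Rightarrow> real"
  assumes "a \<le> b"
    and deriv: "\<And>t. t \<in> {a..b} \<Longrightarrow> (f has_vector_derivative f' t) (at t within {a..b})"
    and le: "\<And>t. t \<in> {a..b} \<Longrightarrow> f' t \<le> 0"
  shows "f b \<le> f a"
proof (rule DERIV_nonpos_imp_decreasing_open[OF assms(1)])
  fix t assume t: "a < t" "t < b"
  then have "at t within {a..b} = at t" by (intro at_within_interior) simp
  then have "(f has_real_derivative f' t) (at t)"
    using deriv[of t] t by (simp add: has_real_derivative_iff_has_vector_derivative)
  then show "\<exists>y. (f has_real_derivative y) (at t) \<and> y \<le> 0" using le[of t] t by auto
next
  show "continuous_on {a..b} f"
    using deriv has_vector_derivative_continuous continuous_on_eq_continuous_within by blast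
qed

lemma min_0_squared_derivative:
  "((\<lambda>x::real. (min 0 x)\<^sup>2) has_real_derivative 2 * min 0 x) (at x)"
proof (cases x "0::real" rule: linorder_cases)
  case less
  have "((\<lambda>x::real. x\<^sup>2) has_real_derivative 2 * x) (at x)"
    by (auto intro!: derivative_eq_intros)
  then have "((\<lambda>x::real. (min 0 x)\<^sup>2) has_real_derivative 2 * x) (at x)"
    by (rule has_field_derivative_transform_within_open[of _ _ _ "{..<0}"]) (use less in auto)
  then show ?thesis using less by simp
next
  case greater
  have "((\<lambda>x::real. 0) has_real_derivative 0) (at x)" by simp
  then have "((\<lambda>x::real. (min 0 x)\<^sup>2) has_real_derivative 0) (at x)"
    by (rule has_field_derivative_transform_within_open[of _ _ _ "{0<..}"]) (use greater in auto)
  then show ?thesis using greater by simp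
next
  case equal
  have "((\<lambda>h::real. (min 0 h)\<^sup>2 / h) \<longlongrightarrow> 0) (at 0)"
  proof (rule Lim_null_comparison)
    show "\<forall>\<^sub>F h in at 0. norm ((min 0 h)\<^sup>2 / h) \<le> \<bar>h::real\<bar>"
      by (rule always_eventually) (auto simp: min_def power2_eq_square)
    show "((\<lambda>h::real. \<bar>h\<bar>) \<longlongrightarrow> 0) (at 0)" by (rule tendsto_rabs_zero) (rule tendsto_ident_at)
  qed
  then show ?thesis using equal by (simp add: DERIV_def)
qed

text \<open>
  The sum \<open>\<phi>\<close> of the squared negative parts vanishes initially and satisfies \<open>\<phi>' \<le> 4 M \<phi>\<close>, where \<open>M\<close> bounds the coefficients: since
  \<open>min 0 f * g \<le> min 0 f * min 0 g\<close>, the coupling terms contribute no more than products of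
  negative parts.
\<close>

lemma cooperative_system_nonneg:
  fixes f g A B C :: "real \<Rightarrow> real"
  assumes "0 \<le> \<tau>"
    and f: "\<And>t. t \<in> {0..\<tau>} \<Longrightarrow> (f has_vector_derivative A t * f t + B t * g t) (at t within {0..\<tau>})"
    and g: "\<And>t. t \<in> {0..\<tau>} \<Longrightarrow> (g has_vector_derivative C t * g t + B t * f t) (at t within {0..\<tau>})"
    and cont: "continuous_on {0..\<tau>} A" "continuous_on {0..\<tau>} B" "continuous_on {0..\<tau>} C"
    and B: "\<And>t. t \<in> {0..\<tau>} \<Longrightarrow> 0 \<le> B t"
    and init: "0 \<le> f 0" "0 \<le> g 0"
  shows "0 \<le> f \<tau>" "0 \<le> g \<tau>"
proof -
  have "\<exists>M>0. \<forall>t\<in>{0..\<tau>}. norm (h t) \<le> M" if "continuous_on {0..\<tau>} h" for h :: "real \<Rightarrow> real"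
    using compact_imp_bounded[OF compact_continuous_image[OF that compact_Icc]]
    unfolding bounded_pos by auto
  from this[OF cont(1)] this[OF cont(2)] this[OF cont(3)] obtain MA MB MC where
    bd: "MA > 0" "MB > 0" "MC > 0" "\<And>t. t \<in> {0..\<tau>} \<Longrightarrow> norm (A t) \<le> MA"
    "\<And>t. t \<in> {0..\<tau>} \<Longrightarrow> norm (B t) \<le> MB" "\<And>t. t \<in> {0..\<tau>} \<Longrightarrow> norm (C t) \<le> MC" by metis
  define M where "M = MA + MB + MC"
  have M: "A t \<le> M" "B t \<le> M" "C t \<le> M" if "t \<in> {0..\<tau>}" for t
    using bd(1-3) bd(4-6)[OF that] by (auto simp: M_def)
  define \<phi> where "\<phi> t = (min 0 (f t))\<^sup>2 + (min 0 (g t))\<^sup>2" for t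
  define \<phi>' where "\<phi>' t = 2 * min 0 (f t) * (A t * f t + B t * g t) + 2 * min 0 (g t) * (C t * g t + B t * f t)" for t
  have \<phi>': "(\<phi> has_real_derivative \<phi>' t) (at t within {0..\<tau>})" if t: "t \<in> {0..\<tau>}" for t
    unfolding \<phi>_def[abs_def] \<phi>'_def
    by (intro DERIV_add DERIV_chain2[OF min_0_squared_derivative])
       (use f[OF t] g[OF t] in \<open>simp_all add: has_real_derivative_iff_has_vector_derivative\<close>)
  have le: "\<phi>' t \<le> 4 * M * \<phi> t" if t: "t \<in> {0..\<tau>}" for t
  proof -
    define a b where "a = min 0 (f t)" and "b = min 0 (g t)"
    have ab: "a \<le> 0" "b \<le> 0" "a * f t = a\<^sup>2" "b * g t = b\<^sup>2" "a * g t \<le> a * b" "b * f t \<le> a * b"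
      by (auto simp: a_def b_def min_def power2_eq_square mult_nonpos_nonneg mult_nonneg_nonpos mult_le_0_iff)
    have "\<phi>' t = 2 * A t * (a * f t) + 2 * C t * (b * g t) + 2 * B t * (a * g t) + 2 * B t * (b * f t)"
      by (simp add: \<phi>'_def a_def b_def algebra_simps)
    also have "\<dots> \<le> 2 * M * a\<^sup>2 + 2 * M * b\<^sup>2 + 2 * M * (a * b) + 2 * M * (a * b)"
    proof -
      have "B t * (a * g t) \<le> M * (a * b)" "B t * (b * f t) \<le> M * (a * b)"
        using B[OF t] M(2)[OF t] ab by (auto intro!: mult_mono' order_trans[OF mult_left_mono mult_right_mono] simp: mult_nonpos_nonpos)
      moreover have "A t * a\<^sup>2 \<le> M * a\<^sup>2" "C t * b\<^sup>2 \<le> M * b\<^sup>2"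
        using M[OF t] by (auto intro: mult_right_mono)
      ultimately show ?thesis unfolding ab(3,4) by simp
    qed
    also have "\<dots> = 4 * M * (a\<^sup>2 + b\<^sup>2) - 2 * M * (a - b)\<^sup>2"
      by (simp add: algebra_simps power2_eq_square)
    also have "\<dots> \<le> 4 * M * (a\<^sup>2 + b\<^sup>2)" using bd(1-3) by (simp add: M_def)
    finally show ?thesis by (simp add: \<phi>_def a_def b_def)
  qed
  have "exp (- 4 * M * \<tau>) * \<phi> \<tau> \<le> exp (- 4 * M * 0) * \<phi> 0"
  proof (rule nonincreasing_from_derivative[OF assms(1)])
    fix t assume t: "t \<in> {0..\<tau>}"
    have "((\<lambda>t. exp (- 4 * M * t)) has_real_derivative exp (- 4 * M * t) * (- 4 * M)) (at t within {0..\<tau>})"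
      by (auto intro!: derivative_eq_intros)
    from DERIV_mult[OF this \<phi>'[OF t]]
    show "((\<lambda>t. exp (- 4 * M * t) * \<phi> t) has_vector_derivative
        exp (- 4 * M * t) * (\<phi>' t - 4 * M * \<phi> t)) (at t within {0..\<tau>})"
      by (simp add: has_real_derivative_iff_has_vector_derivative algebra_simps)
    show "exp (- 4 * M * t) * (\<phi>' t - 4 * M * \<phi> t) \<le> 0"
      using le[OF t] by (simp add: mult_nonneg_nonpos)
  qed
  also have "\<dots> = 0" using init by (simp add: \<phi>_def)
  finally have "\<phi> \<tau> \<le> 0" by (simp add: mult_le_0_iff)
  then have "min 0 (f \<tau>) = 0" "min 0 (g \<tau>) = 0"
    unfolding \<phi>_def by (simp_all add: sum_power2_le_zero_iff)
  then show "0 \<le> f \<tau>" "0 \<le> g \<tau>" by (simp_all add: min_def split: if_splits)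
qed

section \<open>Evolution of length and angles\<close>

locale convex_smooth_domain = smooth_domain +
  assumes convex: "convex \<Omega>" and curvature_nonneg: "convex_boundary \<Omega>"
begin

definition len :: "(real^2) \<times> (real^2) \<Rightarrow> real" where
  "len z = norm (snd z - fst z)"

definition dir :: "(real^2) \<times> (real^2) \<Rightarrow> real^2" where
  "dir z = (snd z - fst z) /\<^sub>R len z"

text \<open>
  \<open>cos1\<close>, \<open>sin1\<close> are the cosine and the sine of the angle \<open>A\<close> between the conormal and the oriented
  boundary tangent at the first end point, and \<open>cos2\<close>, \<open>sin2\<close> those of the angle \<open>B\<close> between the
  conormal and the opposite of the tangent at the second one; then \<open>cos_turn\<close> is the cosine of \<open>A + B\<close>.
\<close>

definition cos1 :: "(real^2) \<times> (real^2) \<Rightarrow> real" where "cos1 z = - (dir z \<bullet> \<xi> (fst z))"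
definition cos2 :: "(real^2) \<times> (real^2) \<Rightarrow> real" where "cos2 z = - (dir z \<bullet> \<xi> (snd z))"
definition sin1 :: "(real^2) \<times> (real^2) \<Rightarrow> real" where "sin1 z = dir z \<bullet> J (\<xi> (fst z))"
definition sin2 :: "(real^2) \<times> (real^2) \<Rightarrow> real" where "sin2 z = - (dir z \<bullet> J (\<xi> (snd z)))"

definition cos_turn :: "(real^2) \<times> (real^2) \<Rightarrow> real" where "cos_turn z = \<xi> (fst z) \<bullet> \<xi> (snd z)"

lemma len_pos: "z \<in> chords \<Longrightarrow> 0 < len z"
  by (auto simp: len_def chords_def)

lemma conormal_dir: "conormal (fst z) (snd z) = - dir z" "conormal (snd z) (fst z) = dir z"
  by (simp_all add: conormal_def dir_def len_def norm_minus_commute scaleR_diff_right)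

lemma angles_eq: "start_angle \<Omega> (fst z) (snd z) = cos1 z" "end_angle \<Omega> (fst z) (snd z) = cos2 z"
  by (simp_all add: start_angle_def end_angle_def conormal_dir cos1_def cos2_def)

lemma convex_chord_iff: "convex_chord \<Omega> (fst z) (snd z) \<longleftrightarrow> 0 \<le> cos1 z \<and> 0 \<le> cos2 z"
  by (simp add: convex_chord_def angles_eq)

lemma norm_dir: "z \<in> chords \<Longrightarrow> norm (dir z) = 1"
  by (auto simp: dir_def len_def chords_def)

lemma norm_\<xi>: "z \<in> chords \<Longrightarrow> norm (\<xi> (fst z)) = 1 \<and> norm (\<xi> (snd z)) = 1"
  using tangent_space_line(1) by (auto simp: chords_def)

text \<open>A convex domain lies on the inner side of each tangent of its boundary; this is applied to the
  tangents at the two end points.\<close>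

lemma sines_nonneg:
  assumes z: "z \<in> chords"
  shows "0 \<le> sin1 z" "0 \<le> sin2 z"
proof -
  have "0 \<le> (snd z - fst z) \<bullet> J (\<xi> (fst z))" "0 \<le> (fst z - snd z) \<bullet> J (\<xi> (snd z))"
    using z by (auto simp: chords_def intro!: supporting_line[OF convex])
  then show "0 \<le> sin1 z" "0 \<le> sin2 z"
    using len_pos[OF z] by (auto simp: sin1_def sin2_def dir_def inner_diff_left intro!: mult_nonneg_nonneg mult_nonneg_nonpos)
qed

lemma angle_relations:
  assumes z: "z \<in> chords"
  shows "(cos1 z)\<^sup>2 + (sin1 z)\<^sup>2 = 1" "(cos2 z)\<^sup>2 + (sin2 z)\<^sup>2 = 1"
    and "cos_turn z = cos1 z * cos2 z - sin1 z * sin2 z"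
    and "\<xi> (fst z) \<bullet> J (\<xi> (snd z)) = cos1 z * sin2 z + sin1 z * cos2 z"
proof -
  note expand = J_basis_inner[OF norm_dir[OF z]]
  have comp: "\<xi> (fst z) \<bullet> dir z = - cos1 z" "\<xi> (fst z) \<bullet> J (dir z) = - sin1 z"
      "\<xi> (snd z) \<bullet> dir z = - cos2 z" "\<xi> (snd z) \<bullet> J (dir z) = sin2 z"
      "J (\<xi> (snd z)) \<bullet> dir z = - sin2 z" "J (\<xi> (snd z)) \<bullet> J (dir z) = - cos2 z"
    using inner_J_left[of "\<xi> (fst z)" "dir z"] inner_J_left[of "\<xi> (snd z)" "dir z"]
    by (simp_all add: cos1_def cos2_def sin1_def sin2_def inner_commute)
  show "(cos1 z)\<^sup>2 + (sin1 z)\<^sup>2 = 1" "(cos2 z)\<^sup>2 + (sin2 z)\<^sup>2 = 1"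
    using expand[of "\<xi> (fst z)" "\<xi> (fst z)"] expand[of "\<xi> (snd z)" "\<xi> (snd z)"] norm_\<xi>[OF z]
    by (simp_all add: comp norm_eq_1 power2_eq_square)
  show "cos_turn z = cos1 z * cos2 z - sin1 z * sin2 z"
    using expand[of "\<xi> (fst z)" "\<xi> (snd z)"] by (simp add: comp cos_turn_def)
  show "\<xi> (fst z) \<bullet> J (\<xi> (snd z)) = cos1 z * sin2 z + sin1 z * cos2 z"
    using expand[of "\<xi> (fst z)" "J (\<xi> (snd z))"] by (simp add: comp)
qed

lemma chord_field_eq: "chord_field z = (- cos1 z *\<^sub>R \<xi> (fst z), cos2 z *\<^sub>R \<xi> (snd z))"
  by (simp add: chord_field_def velocity_def conormal_dir cos1_def cos2_def)

context
  fixes Y :: "real \<Rightarrow> (real^2) \<times> (real^2)" and I :: "real set"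
  assumes ode: "chord_ode Y I"
begin

lemma chords: "t \<in> I \<Longrightarrow> Y t \<in> chords"
  using chord_odeD(1)[OF ode] .

lemma end_points_derivative:
  assumes "t \<in> I"
  shows "((\<lambda>t. fst (Y t)) has_vector_derivative - cos1 (Y t) *\<^sub>R \<xi> (fst (Y t))) (at t within I)"
    and "((\<lambda>t. snd (Y t)) has_vector_derivative cos2 (Y t) *\<^sub>R \<xi> (snd (Y t))) (at t within I)"
  using bounded_linear.has_vector_derivative[OF bounded_linear_fst chord_odeD(2)[OF ode assms]]
    bounded_linear.has_vector_derivative[OF bounded_linear_snd chord_odeD(2)[OF ode assms]]
  by (simp_all add: chord_field_eq)

lemma chord_vector_derivative:
  assumes "t \<in> I"
  shows "((\<lambda>t. snd (Y t) - fst (Y t)) has_vector_derivative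
    cos2 (Y t) *\<^sub>R \<xi> (snd (Y t)) + cos1 (Y t) *\<^sub>R \<xi> (fst (Y t))) (at t within I)"
  using has_vector_derivative_diff[OF end_points_derivative(2,1)[OF assms]] by simp

lemma tangents_derivative:
  assumes "t \<in> I"
  shows "((\<lambda>t. \<xi> (fst (Y t))) has_vector_derivative
      (- cos1 (Y t) * \<kappa> (fst (Y t))) *\<^sub>R J (\<xi> (fst (Y t)))) (at t within I)"
    and "((\<lambda>t. \<xi> (snd (Y t))) has_vector_derivative
      (cos2 (Y t) * \<kappa> (snd (Y t))) *\<^sub>R J (\<xi> (snd (Y t)))) (at t within I)"
  using \<xi>_derivative[OF end_points_derivative(1)[OF assms] assms]
    \<xi>_derivative[OF end_points_derivative(2)[OF assms] assms] chords
  by (auto simp: chords_def image_subset_iff)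

text \<open>The length changes only through the components of the end point velocities along the chord.
  Each end point moves with the opposite of the tangential part of its conormal and so contributes
  minus the square of its cosine.\<close>

lemma length_derivative:
  assumes t: "t \<in> I"
  shows "((\<lambda>t. len (Y t)) has_vector_derivative - ((cos1 (Y t))\<^sup>2 + (cos2 (Y t))\<^sup>2)) (at t within I)"
proof -
  let ?D' = "cos2 (Y t) *\<^sub>R \<xi> (snd (Y t)) + cos1 (Y t) *\<^sub>R \<xi> (fst (Y t))"
  have "snd (Y t) - fst (Y t) \<noteq> 0" using chords[OF t] by (auto simp: chords_def)
  from has_derivative_compose[OF chord_vector_derivative[OF t, unfolded has_vector_derivative_def]
      has_derivative_norm[OF this]]
  have "((\<lambda>t. len (Y t)) has_vector_derivative ?D' \<bullet> dir (Y t)) (at t within I)"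
    by (simp add: has_vector_derivative_def len_def dir_def sgn_div_norm mult.left_commute)
  moreover have "?D' \<bullet> dir (Y t) = - ((cos1 (Y t))\<^sup>2 + (cos2 (Y t))\<^sup>2)"
    by (simp add: inner_diff_right inner_add_right cos1_def cos2_def inner_commute[of _ "dir (Y t)"] power2_eq_square)
  ultimately show ?thesis by simp
qed

lemma cos_turn_derivative:
  assumes t: "t \<in> I"
  shows "((\<lambda>t. cos_turn (Y t)) has_vector_derivative
    (cos1 (Y t) * \<kappa> (fst (Y t)) + cos2 (Y t) * \<kappa> (snd (Y t)))
      * (cos1 (Y t) * sin2 (Y t) + sin1 (Y t) * cos2 (Y t))) (at t within I)"
proof -
  note d = bounded_bilinear.has_vector_derivative[OF bounded_bilinear_inner tangents_derivative[OF t]]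
  show ?thesis
    using d unfolding cos_turn_def
    by (simp add: inner_J_left angle_relations(4)[OF chords[OF t]] algebra_simps)
qed

text \<open>
  The system for the cosines is cooperative once they are multiplied by the length of the chord:
  \<open>len * cos1 = - (q - p) \<bullet> \<xi> p\<close>, whose derivative involves \<open>cos2\<close> through
  \<open>- cos2 * cos_turn = sin1 * sin2 * cos2 - cos1 * cos2\<^sup>2\<close>, so that the coupling coefficient is
  \<open>sin1 * sin2 / len\<close>; the second end point is symmetric.
\<close>

lemma scaled_cosines_derivative:
  assumes t: "t \<in> I"
  shows "((\<lambda>t. len (Y t) * cos1 (Y t)) has_vector_derivative
      (\<kappa> (fst (Y t)) * sin1 (Y t) - (1 + (cos2 (Y t))\<^sup>2) / len (Y t)) * (len (Y t) * cos1 (Y t))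
      + (sin1 (Y t) * sin2 (Y t) / len (Y t)) * (len (Y t) * cos2 (Y t))) (at t within I)" (is ?one)
    and "((\<lambda>t. len (Y t) * cos2 (Y t)) has_vector_derivative
      (\<kappa> (snd (Y t)) * sin2 (Y t) - (1 + (cos1 (Y t))\<^sup>2) / len (Y t)) * (len (Y t) * cos2 (Y t))
      + (sin1 (Y t) * sin2 (Y t) / len (Y t)) * (len (Y t) * cos1 (Y t))) (at t within I)" (is ?two)
proof -
  note ch = chords[OF t]
  have D: "snd (Y s) - fst (Y s) = len (Y s) *\<^sub>R dir (Y s)" if "s \<in> I" for s
    using len_pos[OF chords[OF that]] by (simp add: dir_def)
  have l: "len (Y t) \<noteq> 0" using len_pos[OF ch] by simp
  have unit: "\<xi> (fst (Y t)) \<bullet> \<xi> (fst (Y t)) = 1" "\<xi> (snd (Y t)) \<bullet> \<xi> (snd (Y t)) = 1"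
    using norm_\<xi>[OF ch] by (simp_all add: norm_eq_1)
  have turn: "\<xi> (fst (Y t)) \<bullet> \<xi> (snd (Y t)) = cos1 (Y t) * cos2 (Y t) - sin1 (Y t) * sin2 (Y t)"
    "\<xi> (snd (Y t)) \<bullet> \<xi> (fst (Y t)) = cos1 (Y t) * cos2 (Y t) - sin1 (Y t) * sin2 (Y t)"
    using angle_relations(3)[OF ch] by (simp_all add: cos_turn_def inner_commute)
  have sin: "dir (Y t) \<bullet> J (\<xi> (fst (Y t))) = sin1 (Y t)" "dir (Y t) \<bullet> J (\<xi> (snd (Y t))) = - sin2 (Y t)"
    by (simp_all add: sin1_def sin2_def)
  note dot = bounded_bilinear.has_vector_derivative[OF bounded_bilinear_inner chord_vector_derivative[OF t]]
  have one: "((\<lambda>t. - ((snd (Y t) - fst (Y t)) \<bullet> \<xi> (fst (Y t)))) has_vector_derivative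
      (\<kappa> (fst (Y t)) * sin1 (Y t) - (1 + (cos2 (Y t))\<^sup>2) / len (Y t)) * (len (Y t) * cos1 (Y t))
      + (sin1 (Y t) * sin2 (Y t) / len (Y t)) * (len (Y t) * cos2 (Y t))) (at t within I)"
    by (rule has_vector_derivative_eq_rhs[OF has_vector_derivative_minus[OF dot[OF tangents_derivative(1)[OF t]]]])
       (use l in \<open>simp add: D[OF t] inner_add_left unit turn sin field_simps power2_eq_square\<close>)
  show ?one
    by (rule has_vector_derivative_transform[OF t _ one]) (simp add: D cos1_def)
  have two: "((\<lambda>t. - ((snd (Y t) - fst (Y t)) \<bullet> \<xi> (snd (Y t)))) has_vector_derivative
      (\<kappa> (snd (Y t)) * sin2 (Y t) - (1 + (cos1 (Y t))\<^sup>2) / len (Y t)) * (len (Y t) * cos2 (Y t))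
      + (sin1 (Y t) * sin2 (Y t) / len (Y t)) * (len (Y t) * cos1 (Y t))) (at t within I)"
    by (rule has_vector_derivative_eq_rhs[OF has_vector_derivative_minus[OF dot[OF tangents_derivative(2)[OF t]]]])
       (use l in \<open>simp add: D[OF t] inner_add_left unit turn sin field_simps power2_eq_square\<close>)
  show ?two
    by (rule has_vector_derivative_transform[OF t _ two]) (simp add: D cos2_def)
qed

lemma evolution_coefficients_continuous:
  "continuous_on I (\<lambda>t. \<kappa> (fst (Y t)) * sin1 (Y t) - (1 + (cos2 (Y t))\<^sup>2) / len (Y t))"
  "continuous_on I (\<lambda>t. sin1 (Y t) * sin2 (Y t) / len (Y t))"
  "continuous_on I (\<lambda>t. \<kappa> (snd (Y t)) * sin2 (Y t) - (1 + (cos1 (Y t))\<^sup>2) / len (Y t))"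
proof -
  have Y: "continuous_on I Y" by (rule chord_ode_continuous[OF ode])
  have mem: "fst (Y t) \<in> \<Sigma>" "snd (Y t) \<in> \<Sigma>" "len (Y t) \<noteq> 0" if "t \<in> I" for t
    using chords[OF that] len_pos[OF chords[OF that]] by (auto simp: chords_def)
  have k: "continuous_on I (\<lambda>t. \<kappa> (fst (Y t)))" "continuous_on I (\<lambda>t. \<kappa> (snd (Y t)))"
    and x: "continuous_on I (\<lambda>t. \<xi> (fst (Y t)))" "continuous_on I (\<lambda>t. \<xi> (snd (Y t)))"
    using mem by (auto intro!: continuous_on_compose2[OF \<xi>_\<kappa>_continuous(1)]
        continuous_on_compose2[OF \<xi>_\<kappa>_continuous(2)] continuous_on_fst continuous_on_snd Y)
  have len: "continuous_on I (\<lambda>t. len (Y t))" unfolding len_def by (intro continuous_intros Y)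
  have dir: "continuous_on I (\<lambda>t. dir (Y t))" unfolding dir_def
    using mem by (intro continuous_intros Y len) auto
  have J: "continuous_on I (\<lambda>t. J (\<xi> (fst (Y t))))" "continuous_on I (\<lambda>t. J (\<xi> (snd (Y t))))"
    using x linear_continuous_on_compose[OF _ J_linear] by blast+
  have trig: "continuous_on I (\<lambda>t. cos1 (Y t))" "continuous_on I (\<lambda>t. cos2 (Y t))"
      "continuous_on I (\<lambda>t. sin1 (Y t))" "continuous_on I (\<lambda>t. sin2 (Y t))"
    unfolding cos1_def cos2_def sin1_def sin2_def by (intro continuous_intros dir x J)+
  show "continuous_on I (\<lambda>t. \<kappa> (fst (Y t)) * sin1 (Y t) - (1 + (cos2 (Y t))\<^sup>2) / len (Y t))"
    "continuous_on I (\<lambda>t. sin1 (Y t) * sin2 (Y t) / len (Y t))"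
    "continuous_on I (\<lambda>t. \<kappa> (snd (Y t)) * sin2 (Y t) - (1 + (cos1 (Y t))\<^sup>2) / len (Y t))"
    using mem(3) by (auto intro!: continuous_intros k trig len)
qed

end

lemma convex_chord_preserved:
  assumes ode: "chord_ode Y {0..\<tau>}" and "0 \<le> \<tau>" and init: "0 \<le> cos1 (Y 0)" "0 \<le> cos2 (Y 0)"
  shows "0 \<le> cos1 (Y \<tau>)" "0 \<le> cos2 (Y \<tau>)"
proof -
  have pos: "0 < len (Y t)" if "t \<in> {0..\<tau>}" for t
    by (rule len_pos[OF chords[OF ode that]])
  have B: "0 \<le> sin1 (Y t) * sin2 (Y t) / len (Y t)" if "t \<in> {0..\<tau>}" for t
    using sines_nonneg[OF chords[OF ode that]] pos[OF that] by simp
  have i: "0 \<le> len (Y 0) * cos1 (Y 0)" "0 \<le> len (Y 0) * cos2 (Y 0)"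
    using init pos[of 0] assms(2) by simp_all
  note nonneg = cooperative_system_nonneg[OF assms(2) scaled_cosines_derivative[OF ode]
      evolution_coefficients_continuous[OF ode] B i]
  show "0 \<le> cos1 (Y \<tau>)" "0 \<le> cos2 (Y \<tau>)"
    using nonneg pos[of \<tau>] assms(2) by (simp_all add: zero_le_mult_iff)
qed

lemma cos_turn_nondecreasing:
  assumes ode: "chord_ode Y {0..\<tau>}" and "0 \<le> \<tau>" and init: "0 \<le> cos1 (Y 0)" "0 \<le> cos2 (Y 0)"
  shows "cos_turn (Y 0) \<le> cos_turn (Y \<tau>)"
proof -
  have "- cos_turn (Y \<tau>) \<le> - cos_turn (Y 0)"
  proof (rule nonincreasing_from_derivative[OF assms(2)])
    fix t assume t: "t \<in> {0..\<tau>}"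
    show "((\<lambda>t. - cos_turn (Y t)) has_vector_derivative
      - ((cos1 (Y t) * \<kappa> (fst (Y t)) + cos2 (Y t) * \<kappa> (snd (Y t)))
      * (cos1 (Y t) * sin2 (Y t) + sin1 (Y t) * cos2 (Y t)))) (at t within {0..\<tau>})"
      by (rule has_vector_derivative_minus[OF cos_turn_derivative[OF ode t]])
    have "chord_ode Y {0..t}" by (rule chord_ode_subset[OF ode]) (use t in auto)
    then have "0 \<le> cos1 (Y t)" "0 \<le> cos2 (Y t)"
      using convex_chord_preserved[of Y t] init t by auto
    moreover have "0 \<le> \<kappa> (fst (Y t))" "0 \<le> \<kappa> (snd (Y t))"
      using chords[OF ode t] curvature_nonneg by (auto simp: convex_boundary_def chords_def)
    ultimately show "- ((cos1 (Y t) * \<kappa> (fst (Y t)) + cos2 (Y t) * \<kappa> (snd (Y t)))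
      * (cos1 (Y t) * sin2 (Y t) + sin1 (Y t) * cos2 (Y t))) \<le> 0"
      using sines_nonneg[OF chords[OF ode t]] by simp
  qed
  then show ?thesis by simp
qed

text \<open>
  In terms of the two angles \<open>A\<close>, \<open>B\<close> the bound follows from
  \<open>cos\<^sup>2 A + cos\<^sup>2 B = 1 + cos (A + B) * cos (A - B)\<close> with \<open>0 \<le> cos (A - B) \<le> 1\<close>.
\<close>

lemma cosines_lower_bound:
  assumes z: "z \<in> chords" and c: "0 \<le> cos1 z" "0 \<le> cos2 z"
  shows "1 + min 0 (cos_turn z) \<le> (cos1 z)\<^sup>2 + (cos2 z)\<^sup>2"
proof -
  define \<delta> where "\<delta> = cos1 z * cos2 z + sin1 z * sin2 z"
  note rel = angle_relations(1-3)[OF z]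
  have "0 \<le> \<delta>" using sines_nonneg[OF z] c by (simp add: \<delta>_def)
  have "2 * \<delta> = 2 - (cos1 z - cos2 z)\<^sup>2 - (sin1 z - sin2 z)\<^sup>2"
    unfolding \<delta>_def using rel(1,2) by (simp add: power2_eq_square algebra_simps)
  then have "\<delta> \<le> 1" using zero_le_power2[of "cos1 z - cos2 z"] zero_le_power2[of "sin1 z - sin2 z"] by linarith
  have "(cos1 z)\<^sup>2 + (cos2 z)\<^sup>2 = 1 + cos_turn z * \<delta>"
  proof -
    have "cos_turn z * \<delta> = (cos1 z)\<^sup>2 * (cos2 z)\<^sup>2 - (sin1 z)\<^sup>2 * (sin2 z)\<^sup>2"
      unfolding rel(3) \<delta>_def by (simp add: power2_eq_square algebra_simps)
    also have "\<dots> = (cos1 z)\<^sup>2 * (cos2 z)\<^sup>2 - (1 - (cos1 z)\<^sup>2) * (1 - (cos2 z)\<^sup>2)"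
      using rel(1,2) by (simp add: eq_diff_eq[symmetric] add.commute)
    finally show ?thesis by (simp add: algebra_simps)
  qed
  moreover have "min 0 (cos_turn z) \<le> cos_turn z * \<delta>"
  proof (cases "0 \<le> cos_turn z")
    case True
    then show ?thesis using \<open>0 \<le> \<delta>\<close> by simp
  next
    case False
    then have "cos_turn z * 1 \<le> cos_turn z * \<delta>" using \<open>\<delta> \<le> 1\<close> by (intro mult_left_mono_neg) auto
    then show ?thesis by simp
  qed
  ultimately show ?thesis by simp
qed

text \<open>That is, \<open>A + B < \<pi>\<close> as soon as one of the two angles is less than a right angle.\<close>

lemma cos_turn_greater:
  assumes z: "z \<in> chords" and c: "0 \<le> cos1 z" "0 \<le> cos2 z" and "cos1 z \<noteq> 0 \<or> cos2 z \<noteq> 0"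
  shows "- 1 < cos_turn z"
proof -
  note rel = angle_relations(1-3)[OF z]
  have "2 * (cos_turn z + 1) = (cos1 z + cos2 z)\<^sup>2 + (sin1 z - sin2 z)\<^sup>2"
    using rel by (simp add: power2_eq_square algebra_simps)
  moreover have "0 < (cos1 z + cos2 z)\<^sup>2 + (sin1 z - sin2 z)\<^sup>2"
    using c assms(4) by (intro add_pos_nonneg) auto
  ultimately have "0 < 2 * (cos_turn z + 1)" by simp
  then show ?thesis by simp
qed

lemma length_decreases_linearly:
  assumes ode: "chord_ode Y {0..\<tau>}" and "0 \<le> \<tau>" and init: "0 \<le> cos1 (Y 0)" "0 \<le> cos2 (Y 0)"
  shows "len (Y \<tau>) + (1 + min 0 (cos_turn (Y 0))) * \<tau> \<le> len (Y 0)"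
proof -
  let ?c = "1 + min 0 (cos_turn (Y 0))"
  have "len (Y \<tau>) + ?c * \<tau> \<le> len (Y 0) + ?c * 0"
  proof (rule nonincreasing_from_derivative[OF assms(2)])
    fix t assume t: "t \<in> {0..\<tau>}"
    show "((\<lambda>t. len (Y t) + ?c * t) has_vector_derivative
        - ((cos1 (Y t))\<^sup>2 + (cos2 (Y t))\<^sup>2) + ?c) (at t within {0..\<tau>})"
      by (intro has_vector_derivative_add length_derivative[OF ode t])
         (auto intro!: derivative_eq_intros)
    have sub: "chord_ode Y {0..t}" by (rule chord_ode_subset[OF ode]) (use t in auto)
    have "0 \<le> cos1 (Y t)" "0 \<le> cos2 (Y t)"
      using convex_chord_preserved[OF sub] init t by auto
    moreover have "cos_turn (Y 0) \<le> cos_turn (Y t)"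
      using cos_turn_nondecreasing[OF sub] init t by auto
    ultimately show "- ((cos1 (Y t))\<^sup>2 + (cos2 (Y t))\<^sup>2) + ?c \<le> 0"
      using cosines_lower_bound[OF chords[OF ode t]] by (simp add: min_def split: if_splits)
  qed
  then show ?thesis by simp
qed

lemma non_orthogonal_chord_cosines:
  assumes z: "z \<in> chords" and "\<not> orthogonal_geodesic_chord \<Sigma> (fst z) (snd z)"
  shows "cos1 z \<noteq> 0 \<or> cos2 z \<noteq> 0"
proof (rule ccontr)
  assume "\<not> ?thesis"
  then have "(snd z - fst z) \<bullet> \<xi> (fst z) = 0" "(snd z - fst z) \<bullet> \<xi> (snd z) = 0"
    using len_pos[OF z] by (auto simp: cos1_def cos2_def dir_def)
  then have "orthogonal_geodesic_chord \<Sigma> (fst z) (snd z)"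
    using z by (auto simp: orthogonal_geodesic_chord_def orthogonal_def tangent_space_line chords_def)
  then show False using assms(2) by contradiction
qed

end

section \<open>Convergence to a point\<close>

context smooth_domain
begin

lemma maximal_chord_flow_exists:
  assumes "(p, q) \<in> chords"
  shows "\<exists>C T. maximal_chord_flow \<Sigma> p q C T"
proof -
  obtain Y T where Y: "0 < T" "chord_ode Y (time_interval T)" "Y 0 = (p, q)"
    and max: "\<And>Y' T'. T < T' \<Longrightarrow> chord_ode Y' (time_interval T') \<Longrightarrow>
      (\<And>t. t \<in> time_interval T \<Longrightarrow> Y' t = Y t) \<Longrightarrow> False"
    using maximal_chord_ode[OF assms] by metis
  let ?C = "\<lambda>u t. linepath (fst (Y t)) (snd (Y t)) u"
  have "maximal_chord_flow \<Sigma> p q ?C T"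
    unfolding maximal_chord_flow_def
  proof (intro conjI notI)
    show "chord_shortening_flow \<Sigma> ?C T" by (rule chord_ode_imp_flow[OF Y(1,2)])
    show "?C 0 0 = p" "?C 1 0 = q" by (simp_all add: Y(3) linepath_0' linepath_1')
    assume "\<exists>C' T'. T < T' \<and> chord_shortening_flow \<Sigma> C' T' \<and>
      (\<forall>u\<in>{0..1}. \<forall>t\<in>time_interval T. C' u t = ?C u t)"
    then obtain C' T' where C': "T < T'" "chord_shortening_flow \<Sigma> C' T'"
      "\<And>u t. u \<in> {0..1} \<Longrightarrow> t \<in> time_interval T \<Longrightarrow> C' u t = ?C u t" by blast
    show False
    proof (rule max[OF C'(1) flow_imp_chord_ode(2)[OF C'(2)]])
      show "(C' 0 t, C' 1 t) = Y t" if "t \<in> time_interval T" for t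
        using C'(3)[OF _ that, of 0] C'(3)[OF _ that, of 1] by (simp add: linepath_0' linepath_1')
    qed
  qed
  then show ?thesis by blast
qed

text \<open>At a finite maximal time the two end points must collide, because a limiting chord could be
  continued.\<close>

lemma maximal_flow_collapses:
  assumes max: "maximal_chord_flow \<Sigma> p q C (ereal T)"
  shows "converges_to_point_in_finite_time C (ereal T)"
proof -
  define Y where "Y t = (C 0 t, C 1 t)" for t
  have flow: "chord_shortening_flow \<Sigma> C (ereal T)" using max by (simp add: maximal_chord_flow_def)
  have T: "0 < T" using flow_imp_chord_ode(1)[OF flow] by simp
  have ode: "chord_ode Y {0..<T}"
    using flow_imp_chord_ode(2)[OF flow] unfolding Y_def time_interval_ereal .
  have line: "C u t = linepath (C 0 t) (C 1 t) u" if "t \<in> {0..<T}" "u \<in> {0..1}" for u t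
    using flow_imp_chord_ode(3)[OF flow, of t u] that by simp
  obtain z where lim: "(Y \<longlongrightarrow> z) (at_left T)" and z: "fst z \<in> \<Sigma>" "snd z \<in> \<Sigma>"
    by (rule chord_ode_limit[OF ode T])
  have "z \<notin> chords"
  proof
    assume "z \<in> chords"
    from chord_ode_continuation[OF ode T lim this]
    obtain T' Y' where Y': "T < T'" "chord_ode Y' {0..<T'}" "\<And>t. t \<in> {0..<T} \<Longrightarrow> Y' t = Y t"
      by metis
    let ?C' = "\<lambda>u t. linepath (fst (Y' t)) (snd (Y' t)) u"
    have "chord_shortening_flow \<Sigma> ?C' (ereal T')"
      by (rule chord_ode_imp_flow) (use T Y' in auto)
    moreover have "?C' u t = C u t" if "u \<in> {0..1}" "t \<in> time_interval (ereal T)" for u t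
      using line[of t u] that by (simp add: Y'(3) Y_def)
    moreover have "ereal T < ereal T'" using Y'(1) by simp
    moreover have "\<nexists>C' T'. ereal T < T' \<and> chord_shortening_flow \<Sigma> C' T' \<and>
        (\<forall>u\<in>{0..1}. \<forall>t\<in>time_interval (ereal T). C' u t = C u t)"
      using max unfolding maximal_chord_flow_def by (elim conjE)
    ultimately show False by blast
  qed
  then have eq: "snd z = fst z" using z by (auto simp: chords_def)
  have "uniform_limit {0..1} (\<lambda>t u. C u t) (\<lambda>u. fst z) (at_left T)"
    unfolding uniform_limit_iff
  proof (intro allI impI)
    fix e :: real assume "0 < e"
    have "\<forall>\<^sub>F t in at_left T. dist (fst (Y t)) (fst z) < e"
      by (rule tendstoD[OF tendsto_fst[OF lim] \<open>0 < e\<close>])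
    moreover have "\<forall>\<^sub>F t in at_left T. dist (snd (Y t)) (fst z) < e"
      using tendstoD[OF tendsto_snd[OF lim] \<open>0 < e\<close>] by (simp add: eq)
    moreover have "\<forall>\<^sub>F t in at_left T. t \<in> {0..<T}"
      using T unfolding eventually_at_left_field by (intro exI[of _ 0]) auto
    ultimately show "\<forall>\<^sub>F t in at_left T. \<forall>u\<in>{0..1}. dist (C u t) (fst z) < e"
    proof eventually_elim
      case (elim t)
      show ?case
      proof
        fix u :: real assume u: "u \<in> {0..1}"
        have "C 0 t \<in> ball (fst z) e" "C 1 t \<in> ball (fst z) e"
          using elim by (simp_all add: Y_def dist_commute)
        then have "closed_segment (C 0 t) (C 1 t) \<subseteq> ball (fst z) e"
          by (intro closed_segment_subset convex_ball)
        moreover have "C u t \<in> closed_segment (C 0 t) (C 1 t)"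
          using line[OF elim(3) u] linepath_in_path[OF u] by simp
        ultimately show "dist (C u t) (fst z) < e" by (auto simp: dist_commute)
      qed
    qed
  qed
  then show ?thesis unfolding converges_to_point_in_finite_time_def by blast
qed

end

theorem theorem6p5:
  fixes \<Omega> :: "(real^2) set" and p q :: "real^2"
  assumes "compact \<Omega>" and "connected \<Omega>"
    and "smooth_boundary \<Omega>" and "convex_boundary \<Omega>"
    and "p \<in> frontier \<Omega>" and "q \<in> frontier \<Omega>" and "p \<noteq> q"
    and "convex_chord \<Omega> p q"
    and "\<not> orthogonal_geodesic_chord (frontier \<Omega>) p q"
  shows "(\<exists>C T. maximal_chord_flow (frontier \<Omega>) p q C T) \<and>
         (\<forall>C T. maximal_chord_flow (frontier \<Omega>) p q C T \<longrightarrow>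
            converges_to_point_in_finite_time C T)"
proof -
  interpret smooth_domain \<Omega>
    by unfold_locales (use assms compact_imp_closed in auto)
  interpret convex_smooth_domain \<Omega>
    by unfold_locales (use convex_domain assms in auto)
  have z: "(p, q) \<in> chords" using assms(5-7) by (simp add: chords_def)
  have c: "0 \<le> cos1 (p, q)" "0 \<le> cos2 (p, q)"
    using assms(8) convex_chord_iff[of "(p, q)"] by simp_all
  define \<gamma> where "\<gamma> = 1 + min 0 (cos_turn (p, q))"
  have "cos1 (p, q) \<noteq> 0 \<or> cos2 (p, q) \<noteq> 0"
    using non_orthogonal_chord_cosines[OF z] assms(9) by simp
  from cos_turn_greater[OF z c this] have \<gamma>: "0 < \<gamma>" by (simp add: \<gamma>_def)
  have "converges_to_point_in_finite_time C T" if max: "maximal_chord_flow \<Sigma> p q C T" for C T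
  proof -
    have flow: "chord_shortening_flow \<Sigma> C T" "C 0 0 = p" "C 1 0 = q"
      using max by (auto simp: maximal_chord_flow_def)
    have "T \<noteq> \<infinity>"
    proof
      assume T: "T = \<infinity>"
      define Y \<tau> where "Y t = (C 0 t, C 1 t)" and "\<tau> = len (p, q) / \<gamma>" for t
      have Y0: "Y 0 = (p, q)" using flow by (simp add: Y_def)
      have \<tau>: "0 \<le> \<tau>" using \<gamma> len_pos[OF z] by (simp add: \<tau>_def)
      have ode: "chord_ode Y {0..\<tau>}"
        using flow_imp_chord_ode(2)[OF flow(1)] unfolding Y_def
        by (rule chord_ode_subset) (auto simp: T time_interval_def)
      have "len (Y \<tau>) + \<gamma> * \<tau> \<le> len (p, q)"
        using length_decreases_linearly[OF ode \<tau>] c by (simp add: Y0 \<gamma>_def)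
      moreover have "\<gamma> * \<tau> = len (p, q)" using \<gamma> by (simp add: \<tau>_def)
      moreover have "0 < len (Y \<tau>)" using \<tau> by (intro len_pos chords[OF ode]) simp
      ultimately show False by simp
    qed
    moreover have "0 < T" by (rule flow_imp_chord_ode(1)[OF flow(1)])
    ultimately obtain T' where "T = ereal T'" by (cases T) auto
    then show ?thesis using maximal_flow_collapses[of p q C T'] max by simp
  qed
  then show ?thesis using maximal_chord_flow_exists[OF z] by blast
qed

end
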